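(* Let $1<p<\infty$. Let $\omega_0$ be an $A_p$ weight on $\mathbb{R}^d$, or more generally, a weight such that $\sup_{0<s\le 1}T_s^\Delta(|f|)$ is bounded on $L^p(\mathbb{R}^d,\omega_0(x)dx)$. Then the Ornstein-Uhlenbeck maximal operator $\mathcal{H}^*$ is bounded with respect to the weight $$\omega(x)=\omega_0(x)e^{-\frac{p|x|^2}{2}}.$$ In other words, $$\|\mathcal{H}^*f\|^p_{L^p(\omega(x)dx)}\le C\left([\omega_0]_{A_p}\right)\|f\|^p_{L^p(\omega(x)dx)},$$ with $C\left([\omega_0]_{A_p}\right)$ a constant depending on the characteristic of $\omega_0$ and on $d$ and $p$.
   Context: A weight is a (measurable) function $\mathbb{R}^d\to(0,\infty)$. A weight $\omega_0$ belongs to the standard Muckenhoupt class $A_p$ iff its characteristic $[\omega_0]_{A_p}:=\sup_Q\left(\frac1{|Q|}\int_Q\omega_0(x)\,dx\right)^{1/p}\left(\frac1{|Q|}\int_Q\omega_0^{-\frac1{p-1}}(x)\,dx\right)^{\frac{p-1}p}$ is finite, the supremum being over all cubes $Q\subseteq\mathbb{R}^d$ with sides parallel to the axes. Heat semigroup: $T_s^\Delta f(x)=\frac1{(4\pi s)^{d/2}}\int_{\mathbb{R}^d}e^{-|x-y|^2/(4s)}f(y)\,dy$ for $s>0$. Boundedness of $\sup_{0<s\le1}T_s^\Delta(|f|)$ on $L^p(\mathbb{R}^d,\omega_0(x)dx)$ means boundedness of the operator $f\mapsto\sup_{0<s\le1}T_s^\Delta(|f|)$ on that space. Ornstein-Uhlenbeck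 semigroup and maximal operator: for $t>0$, $\mathcal{H}_tf(x)=\int_{\mathbb{R}^d}M_t(x,y)f(y)\,dy$ with $M_t(x,y)=\left(\frac{1}{\pi(1-e^{-2t})}\right)^{d/2}\exp\left(-\frac{|e^{-t}x-y|^2}{1-e^{-2t}}\right)$, and $\mathcal{H}^*(f)(x)=\sup_{t>0}\mathcal{H}_t(|f|)(x)$. *)

theory Defs
  imports "HOL-Analysis.Analysis"
begin

section \<open>Weights and weighted Lebesgue spaces\<close>

definition weight :: "(real ^ 'n \<Rightarrow> real) \<Rightarrow> bool" where
  "weight w \<longleftrightarrow> w \<in> borel_measurable lebesgue \<and> (\<forall>x. 0 < w x)"

text \<open>Power with a positive real exponent on \<open>[0, \<infinity>]\<close>.\<close>

definition epowr :: "ennreal \<Rightarrow> real \<Rightarrow> ennreal" where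
  "epowr a r = (if a = \<infinity> then \<infinity> else ennreal (enn2real a powr r))"

text \<open>The \<open>p\<close>-th power of the norm in \<open>L\<^sup>p(w(x)dx)\<close>, for functions with values in \<open>[0, \<infinity>]\<close>.\<close>

definition Lp_norm_pow :: "real \<Rightarrow> (real ^ 'n \<Rightarrow> real) \<Rightarrow> (real ^ 'n \<Rightarrow> ennreal) \<Rightarrow> ennreal" where
  "Lp_norm_pow p w g = (\<integral>\<^sup>+ x. epowr (g x) p \<partial>(density lebesgue (\<lambda>x. ennreal (w x))))"

definition Lp_space :: "real \<Rightarrow> (real ^ 'n \<Rightarrow> real) \<Rightarrow> (real ^ 'n \<Rightarrow> complex) set" where
  "Lp_space p w =
     {f \<in> borel_measurable lebesgue. Lp_norm_pow p w (\<lambda>x. ennreal (norm (f x))) < \<infinity>}"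

text \<open>The maximal operators below take values in \<open>[0, \<infinity>]\<close>. The constant \<open>K\<close> bounds the
  \<open>p\<close>-th powers of the norms, so it is the \<open>p\<close>-th power of a bound for the operator norm.\<close>

definition Lp_bounded_by ::
  "real \<Rightarrow> (real ^ 'n \<Rightarrow> real) \<Rightarrow> ((real ^ 'n \<Rightarrow> complex) \<Rightarrow> real ^ 'n \<Rightarrow> ennreal) \<Rightarrow> real \<Rightarrow> bool" where
  "Lp_bounded_by p w T K \<longleftrightarrow>
     (\<forall>f \<in> Lp_space p w. T f \<in> borel_measurable lebesgue \<and>
        Lp_norm_pow p w (T f) \<le> ennreal K * Lp_norm_pow p w (\<lambda>x. ennreal (norm (f x))))"

definition Lp_bounded ::
  "real \<Rightarrow> (real ^ 'n \<Rightarrow> real) \<Rightarrow> ((real ^ 'n \<Rightarrow> complex) \<Rightarrow> real ^ 'n \<Rightarrow> ennreal) \<Rightarrow> bool" where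
  "Lp_bounded p w T \<longleftrightarrow> (\<exists>K. Lp_bounded_by p w T K)"

section \<open>The Muckenhoupt class\<close>

definition cubes :: "(real ^ 'n) set set" where
  "cubes = {cbox a (\<chi> i. a $ i + l) | a l. 0 < l}"

definition avg :: "(real ^ 'n) set \<Rightarrow> (real ^ 'n \<Rightarrow> real) \<Rightarrow> ennreal" where
  "avg Q g = (\<integral>\<^sup>+ x \<in> Q. ennreal (g x) \<partial>lebesgue) / emeasure lebesgue Q"

definition Ap_char :: "real \<Rightarrow> (real ^ 'n \<Rightarrow> real) \<Rightarrow> ennreal" where
  "Ap_char p w =
     (SUP Q \<in> cubes. epowr (avg Q w) (1 / p) *
        epowr (avg Q (\<lambda>x. w x powr (- 1 / (p - 1)))) ((p - 1) / p))"

definition Ap_weight :: "real \<Rightarrow> (real ^ 'n \<Rightarrow> real) \<Rightarrow> bool" where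
  "Ap_weight p w \<longleftrightarrow> weight w \<and> Ap_char p w < \<infinity>"

section \<open>The heat and Ornstein-Uhlenbeck maximal operators\<close>

text \<open>Both semigroups are only ever applied to \<open>|f| \<ge> 0\<close>, so they are defined on functions with
  values in \<open>[0, \<infinity>]\<close>, where the integrals always exist.\<close>

definition heat_kernel :: "real \<Rightarrow> real ^ 'n \<Rightarrow> real ^ 'n \<Rightarrow> real" where
  "heat_kernel s x y =
     1 / (4 * pi * s) powr (real CARD('n) / 2) * exp (- (norm (x - y))\<^sup>2 / (4 * s))"

definition heat_semigroup :: "real \<Rightarrow> (real ^ 'n \<Rightarrow> ennreal) \<Rightarrow> real ^ 'n \<Rightarrow> ennreal" where
  "heat_semigroup s g x = (\<integral>\<^sup>+ y. ennreal (heat_kernel s x y) * g y \<partial>lebesgue)"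

definition local_heat_maximal :: "(real ^ 'n \<Rightarrow> complex) \<Rightarrow> real ^ 'n \<Rightarrow> ennreal" where
  "local_heat_maximal f x = (SUP s \<in> {0<..1}. heat_semigroup s (\<lambda>y. ennreal (norm (f y))) x)"

definition OU_kernel :: "real \<Rightarrow> real ^ 'n \<Rightarrow> real ^ 'n \<Rightarrow> real" where
  "OU_kernel t x y =
     (1 / (pi * (1 - exp (- 2 * t)))) powr (real CARD('n) / 2) *
     exp (- (norm (exp (- t) *\<^sub>R x - y))\<^sup>2 / (1 - exp (- 2 * t)))"

definition OU_semigroup :: "real \<Rightarrow> (real ^ 'n \<Rightarrow> ennreal) \<Rightarrow> real ^ 'n \<Rightarrow> ennreal" where
  "OU_semigroup t g x = (\<integral>\<^sup>+ y. ennreal (OU_kernel t x y) * g y \<partial>lebesgue)"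

definition OU_maximal :: "(real ^ 'n \<Rightarrow> complex) \<Rightarrow> real ^ 'n \<Rightarrow> ennreal" where
  "OU_maximal f x = (SUP t \<in> {0<..}. OU_semigroup t (\<lambda>y. ennreal (norm (f y))) x)"

definition gauss_weight :: "real \<Rightarrow> (real ^ 'n \<Rightarrow> real) \<Rightarrow> real ^ 'n \<Rightarrow> real" where
  "gauss_weight p w x = w x * exp (- p * (norm x)\<^sup>2 / 2)"

end

theory Submission
  imports Defs
begin

text \<open>Put \<open>F y = |f y| exp (-|y|\<^sup>2 / 2)\<close>, so that the norm of \<open>f\<close> in \<open>L\<^sup>p(\<omega>)\<close> is the norm of \<open>F\<close> in
  \<open>L\<^sup>p(\<omega>\<^sub>0)\<close>. Conjugating the Mehler kernel by the Gaussian gives a kernel that is pointwise at most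
  \<open>2\<^sup>d\<close> times the heat kernel at time \<open>s = tanh (t / 2) < 1\<close>; hence
  \<open>exp (-|x|\<^sup>2 / 2) \<H>\<^sup>* f x\<close> is at most \<open>2\<^sup>d\<close> times the local heat maximal function of \<open>F\<close>, whose
  boundedness on \<open>L\<^sup>p(\<omega>\<^sub>0)\<close> is what is needed. For an \<open>A\<^sub>p\<close> weight it follows
  from Muckenhoupt's theorem, since heat averages are sums of ball averages with rapidly decreasing coefficients.
  Muckenhoupt's theorem is obtained by Lerner's argument: \<open>A\<^sub>p\<close> makes \<open>\<omega>\<^sub>0\<close> and the dual weight
  \<open>\<sigma>\<close> doubling, and the maximal function is dominated by a composition of the maximal functions
  with respect to \<open>\<sigma> dx\<close> and \<open>\<omega>\<^sub>0 dx\<close>, which are bounded by the Vitali covering lemma.\<close>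

section \<open>Maximal functions of doubling measures\<close>

lemma epowr_ennreal: "0 \<le> x \<Longrightarrow> epowr (ennreal x) r = ennreal (x powr r)"
  by (simp add: epowr_def)

lemma epowr_top [simp]: "epowr top r = top"
  by (simp add: epowr_def)

lemma epowr_0 [simp]: "epowr 0 r = 0"
  by (simp add: epowr_def)

lemma epowr_mono:
  assumes "a \<le> b" "0 \<le> r"
  shows "epowr a r \<le> epowr b r"
  using assms
  by (cases a rule: ennreal_cases; cases b rule: ennreal_cases)
    (auto simp: epowr_ennreal top_unique powr_mono2)

text \<open>No sign condition on \<open>r\<close> arises: \<open>epowr\<close> fixes
  \<open>0\<close> and \<open>top\<close> for every exponent, which agrees with
  \<open>0 * top = 0\<close>.\<close>

lemma epowr_mult: "epowr (a * b) r = epowr a r * epowr b r"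
  by (cases a rule: ennreal_cases; cases b rule: ennreal_cases; cases "a = 0"; cases "b = 0")
    (auto simp: epowr_ennreal powr_mult ennreal_mult_top ennreal_top_mult
      simp flip: ennreal_mult)

lemma epowr_epowr: "epowr (epowr a r) s = epowr a (r * s)"
  by (cases a rule: ennreal_cases) (auto simp: epowr_ennreal powr_powr)

lemma epowr_add: "epowr a r * epowr a s = epowr a (r + s)"
  by (cases a rule: ennreal_cases)
    (auto simp: epowr_ennreal powr_add ennreal_top_mult simp flip: ennreal_mult)

lemma epowr_1 [simp]: "epowr a 1 = a"
  by (cases a rule: ennreal_cases) (auto simp: epowr_ennreal)

lemma epowr_eq_0_iff [simp]: "epowr a r = 0 \<longleftrightarrow> a = 0"
  by (cases a rule: ennreal_cases) (auto simp: epowr_ennreal ennreal_eq_0_iff)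

lemma measurable_epowr [measurable]:
  assumes [measurable]: "f \<in> borel_measurable M"
  shows "(\<lambda>x. epowr (f x) r) \<in> borel_measurable M"
  unfolding epowr_def by measurable

lemma nn_integral_powr:
  assumes "0 < q" "0 \<le> x"
  shows "(\<integral>\<^sup>+t. ennreal (t powr (q - 1)) * indicator {0<..<x} t \<partial>lborel) = ennreal (x powr q / q)"
proof -
  have "((\<lambda>t. t powr (q - 1)) has_integral (x powr (q - 1 + 1) / (q - 1 + 1))) {0..x}"
    using assms by (intro has_integral_powr_from_0) auto
  then have "(\<integral>\<^sup>+t. ennreal (t powr (q - 1)) * indicator {0..x} t \<partial>lborel) = ennreal (x powr q / q)"
    by (intro nn_integral_has_integral_lebesgue') auto
  moreover have "(\<integral>\<^sup>+t. ennreal (t powr (q - 1)) * indicator {0<..<x} t \<partial>lborel)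
      = (\<integral>\<^sup>+t. ennreal (t powr (q - 1)) * indicator {0..x} t \<partial>lborel)"
    using AE_lborel_singleton[of 0] AE_lborel_singleton[of x]
    by (intro nn_integral_cong_AE) (auto split: split_indicator)
  ultimately show ?thesis by simp
qed

text \<open>For finite \<open>a\<close> the set is an open interval and the integral is explicit.
  For \<open>a = top\<close> the integrals over finite intervals are unbounded lower bounds.\<close>

lemma epowr_layer_cake:
  assumes "0 < q"
  shows "(\<integral>\<^sup>+t. ennreal (t powr (q - 1)) * indicator {t. 0 < t \<and> ennreal t < a} t \<partial>lborel)
    = ennreal (1 / q) * epowr a q"
proof (cases a rule: ennreal_cases)
  case (real x)
  then have "{t. 0 < t \<and> ennreal t < a} = {0<..<x}"
    by (auto simp: ennreal_less_iff)
  then show ?thesis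
    using nn_integral_powr[OF assms, of x] real assms
    by (simp add: epowr_ennreal flip: ennreal_mult)
next
  case top
  let ?I = "\<integral>\<^sup>+t. ennreal (t powr (q - 1)) * indicator {t. 0 < t \<and> ennreal t < a} t \<partial>lborel"
  have lower: "ennreal (x powr q / q) \<le> ?I" if "0 \<le> x" for x
    unfolding nn_integral_powr[OF assms that, symmetric] top
    by (intro nn_integral_mono) (auto split: split_indicator)
  have "?I = top"
  proof (rule ccontr)
    assume "?I \<noteq> top"
    then obtain y where y: "0 \<le> y" "?I = ennreal y" by (cases ?I rule: ennreal_cases) auto
    \<comment> \<open>The endpoint is chosen so that the lower bound equals
      \<open>y + 1\<close>.\<close>
    have "ennreal (((q * (y + 1)) powr (1 / q)) powr q / q) \<le> ennreal y"
      using lower[of "(q * (y + 1)) powr (1 / q)"] y by simp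
    then show False using assms y by (simp add: powr_powr)
  qed
  then show ?thesis using assms top by (simp add: ennreal_mult_top)
qed

section \<open>Maximal functions: weak and strong type\<close>

text \<open>The uncentred Hardy-Littlewood maximal function: the balls only have to contain
  \<open>x\<close>. Its superlevel sets are therefore unions of balls, hence open.\<close>

definition maxfun :: "'a::metric_space measure \<Rightarrow> ('a \<Rightarrow> ennreal) \<Rightarrow> 'a \<Rightarrow> ennreal" where
  "maxfun M g x = (SUP (c, r) \<in> {(c, r). x \<in> ball c r}.
     (\<integral>\<^sup>+ y \<in> ball c r. g y \<partial>M) / emeasure M (ball c r))"

lemma less_maxfun_iff:
  "t < maxfun M g x \<longleftrightarrow>
    (\<exists>c r. x \<in> ball c r \<and> t < (\<integral>\<^sup>+ y \<in> ball c r. g y \<partial>M) / emeasure M (ball c r))"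
  unfolding maxfun_def by (subst less_SUP_iff) auto

lemma average_le_maxfun:
  assumes "x \<in> ball c r"
  shows "(\<integral>\<^sup>+ y \<in> ball c r. g y \<partial>M) / emeasure M (ball c r) \<le> maxfun M g x"
  unfolding maxfun_def using assms by (intro SUP_upper2[of "(c, r)"]) auto

lemma open_maxfun_greater: "open {x. t < maxfun M g x}"
proof -
  have "{x. t < maxfun M g x} = (\<Union>(c, r) \<in> {(c, r). t < (\<integral>\<^sup>+ y \<in> ball c r. g y \<partial>M) / emeasure M (ball c r)}. ball c r)"
    by (auto simp: less_maxfun_iff simp del: mem_ball)
  then show ?thesis by auto
qed

lemma measurable_maxfun [measurable]:
  fixes M :: "'a::euclidean_space measure"
  shows "maxfun M g \<in> borel_measurable lebesgue"
  by (rule borel_measurableI_greater) (simp add: open_maxfun_greater)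

lemma ball_sets_lebesgue [measurable]: "ball (c::'a::euclidean_space) r \<in> sets lebesgue"
  by simp

text \<open>The factor 5 is the enlargement in the Vitali covering lemma. Positive finite measure of
  balls allows averages to be cleared of denominators.\<close>

locale doubling_measure =
  fixes M :: "'a::euclidean_space measure" and D :: real
  assumes sets_eq [measurable_cong]: "sets M = sets lebesgue"
    and ball_pos: "0 < r \<Longrightarrow> 0 < emeasure M (ball c r)"
    and ball_finite: "emeasure M (ball c r) < top"
    and doubling: "0 < r \<Longrightarrow> emeasure M (ball c (5 * r)) \<le> ennreal D * emeasure M (ball c r)"
begin

lemma space_eq [simp]: "space M = UNIV"
  using sets_eq_imp_space_eq[OF sets_eq] by simp

lemma open_sets [simp, measurable]: "open S \<Longrightarrow> S \<in> sets M"
  by (simp add: sets_eq)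

lemma less_average_iff:
  assumes "x \<in> ball c r"
  shows "t < a / emeasure M (ball c r) \<longleftrightarrow> t * emeasure M (ball c r) < a"
proof -
  have "0 < r" using assms by (metis ball_eq_empty empty_iff not_le)
  then have "emeasure M (ball c r) \<noteq> 0" "emeasure M (ball c r) < top"
    using ball_pos[of r c] ball_finite by auto
  then have b: "emeasure M (ball c r) * inverse (emeasure M (ball c r)) = 1"
    by (metis divide_ennreal_def ennreal_divide_self)
  have "a / emeasure M (ball c r) \<le> t \<longleftrightarrow> a \<le> t * emeasure M (ball c r)"
  proof
    assume "a / emeasure M (ball c r) \<le> t"
    then have "a / emeasure M (ball c r) * emeasure M (ball c r) \<le> t * emeasure M (ball c r)"
      by (rule mult_right_mono) simp
    then show "a \<le> t * emeasure M (ball c r)"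
      using b by (simp add: divide_ennreal_def mult.assoc mult.commute[of "inverse _"])
  next
    assume "a \<le> t * emeasure M (ball c r)"
    then have "a / emeasure M (ball c r) \<le> t * emeasure M (ball c r) / emeasure M (ball c r)"
      by (rule divide_right_mono_ennreal)
    then show "a / emeasure M (ball c r) \<le> t"
      using b by (simp add: divide_ennreal_def mult.assoc)
  qed
  then show ?thesis by (simp add: not_le[symmetric])
qed

lemma sigma_finite: "sigma_finite_measure M"
proof
  show "\<exists>A. countable A \<and> A \<subseteq> sets M \<and> \<Union> A = space M \<and> (\<forall>a\<in>A. emeasure M a \<noteq> \<infinity>)"
  proof (intro exI[of _ "range (\<lambda>n::nat. ball 0 (real n))"] conjI)
    show "\<Union> (range (\<lambda>n::nat. ball 0 (real n))) = space M"
      by (auto simp: reals_Archimedean2)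
    show "\<forall>a\<in>range (\<lambda>n::nat. ball 0 (real n)). emeasure M a \<noteq> \<infinity>"
      using ball_finite by (auto simp: less_top)
  qed auto
qed

text \<open>Vitali's lemma, applicable because the radii are bounded, selects disjoint balls whose
  fivefold enlargements cover the union. Doubling pays \<open>D\<close> for shrinking back, and
  disjointness bounds the sum of the integrals by the total integral.\<close>

lemma weak_type_bounded_radii:
  assumes [measurable]: "g \<in> borel_measurable lebesgue"
  shows "t * emeasure M (\<Union>(c, r) \<in> {(c, r). 0 < r \<and> r \<le> R \<and>
      t * emeasure M (ball c r) < (\<integral>\<^sup>+ y \<in> ball c r. g y \<partial>M)}. ball c r)
    \<le> ennreal D * (\<integral>\<^sup>+ y. g y \<partial>M)"
proof -
  define K where "K = {(c, r). 0 < r \<and> r \<le> R \<and>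
      t * emeasure M (ball c r) < (\<integral>\<^sup>+ y \<in> ball c r. g y \<partial>M)}"
  have radii: "0 < snd i \<and> snd i \<le> R" if "i \<in> K" for i
    using that by (auto simp: K_def)
  obtain C where C: "countable C" "C \<subseteq> K"
     "pairwise (\<lambda>i j. disjnt (cball (fst i) (snd i)) (cball (fst j) (snd j))) C"
     and cover: "\<And>i. i \<in> K \<Longrightarrow> \<exists>j. j \<in> C \<and>
       \<not> disjnt (cball (fst i) (snd i)) (cball (fst j) (snd j)) \<and>
       cball (fst i) (snd i) \<subseteq> ball (fst j) (5 * snd j)"
    by (rule Vitali_covering_lemma_cballs_balls[of K snd R fst, OF radii]) auto
  define B where "B k = (if k \<in> to_nat_on C ` C
    then ball (fst (from_nat_into C k)) (snd (from_nat_into C k)) else {})" for k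
  define B5 where "B5 k = (if k \<in> to_nat_on C ` C
    then ball (fst (from_nat_into C k)) (5 * snd (from_nat_into C k)) else {})" for k
  have [measurable]: "B k \<in> sets M" "B5 k \<in> sets M" for k
    by (auto simp: B_def B5_def)
  have mem: "from_nat_into C k \<in> C" if "k \<in> to_nat_on C ` C" for k
    using that C(1) by auto
  have disj: "disjoint_family B"
  proof (unfold disjoint_family_on_def, intro ballI impI)
    fix k l :: nat assume "k \<noteq> l"
    show "B k \<inter> B l = {}"
    proof (cases "k \<in> to_nat_on C ` C \<and> l \<in> to_nat_on C ` C")
      case True
      then have "from_nat_into C k \<noteq> from_nat_into C l"
        using \<open>k \<noteq> l\<close> C(1) by auto
      then have "disjnt (cball (fst (from_nat_into C k)) (snd (from_nat_into C k)))
         (cball (fst (from_nat_into C l)) (snd (from_nat_into C l)))"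
        using C(3) mem True by (auto simp: pairwise_def)
      moreover have "B k \<subseteq> cball (fst (from_nat_into C k)) (snd (from_nat_into C k))"
        "B l \<subseteq> cball (fst (from_nat_into C l)) (snd (from_nat_into C l))"
        using True by (auto simp: B_def)
      ultimately show ?thesis by (auto simp: disjnt_def)
    qed (auto simp: B_def)
  qed
  have "(\<Union>(c, r) \<in> K. ball c r) \<subseteq> (\<Union>k. B5 k)"
  proof
    fix x assume "x \<in> (\<Union>(c, r) \<in> K. ball c r)"
    then obtain i where i: "i \<in> K" "x \<in> ball (fst i) (snd i)" by auto
    then obtain j where j: "j \<in> C" "cball (fst i) (snd i) \<subseteq> ball (fst j) (5 * snd j)"
      using cover by blast
    then have "x \<in> ball (fst j) (5 * snd j)"
      using i(2) ball_subset_cball by blast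
    then have "x \<in> B5 (to_nat_on C j)"
      using j C(1) by (simp add: B5_def)
    then show "x \<in> (\<Union>k. B5 k)" by blast
  qed
  then have "emeasure M (\<Union>(c, r) \<in> K. ball c r) \<le> emeasure M (\<Union>k. B5 k)"
    by (intro emeasure_mono) auto
  also have "\<dots> \<le> (\<Sum>k. emeasure M (B5 k))"
    by (intro emeasure_subadditive_countably) auto
  finally have "t * emeasure M (\<Union>(c, r) \<in> K. ball c r) \<le> (\<Sum>k. t * emeasure M (B5 k))"
    by (simp add: mult_left_mono)
  \<comment> \<open>Integrals of \<open>g\<close> are read as values of the measure
    \<open>density M g\<close>, which is countably additive on the disjoint
    \<open>B k\<close>.\<close>
  also have "\<dots> \<le> (\<Sum>k. ennreal D * emeasure (density M g) (B k))"
  proof (intro suminf_le)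
    fix k
    show "t * emeasure M (B5 k) \<le> ennreal D * emeasure (density M g) (B k)"
    proof (cases "k \<in> to_nat_on C ` C")
      case True
      define j where "j = from_nat_into C k"
      have B: "B k = ball (fst j) (snd j)" "B5 k = ball (fst j) (5 * snd j)"
        using True by (auto simp: B_def B5_def j_def)
      have j: "0 < snd j"
        "t * emeasure M (ball (fst j) (snd j)) < (\<integral>\<^sup>+ y \<in> ball (fst j) (snd j). g y \<partial>M)"
        using mem[OF True] C(2) by (auto simp: K_def j_def)
      have "t * emeasure M (B5 k) \<le> t * (ennreal D * emeasure M (B k))"
        unfolding B using doubling[of "snd j" "fst j"] j by (intro mult_left_mono) auto
      also have "\<dots> \<le> ennreal D * (\<integral>\<^sup>+ y \<in> B k. g y \<partial>M)"
        using mult_left_mono[OF less_imp_le[OF j(2)], of "ennreal D"] unfolding B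
        by (simp add: mult.left_commute)
      finally show ?thesis by (subst emeasure_density) auto
    qed (simp add: B_def B5_def)
  qed auto
  also have "\<dots> = ennreal D * emeasure (density M g) (\<Union>k. B k)"
    by (subst suminf_emeasure[symmetric]) (auto simp: disj)
  also have "\<dots> \<le> ennreal D * emeasure (density M g) UNIV"
    using emeasure_space[of "density M g"] by (intro mult_left_mono) auto
  also have "\<dots> = ennreal D * (\<integral>\<^sup>+ y. g y \<partial>M)"
    by (subst emeasure_density) (auto simp: sets_eq)
  finally show ?thesis unfolding K_def .
qed

text \<open>The sets of the bounded-radius estimate increase with the bound and cover the superlevel
  set; continuity from below passes to the limit.\<close>

lemma weak_type:
  assumes [measurable]: "g \<in> borel_measurable lebesgue"
  shows "t * emeasure M {x. t < maxfun M g x} \<le> ennreal D * (\<integral>\<^sup>+ y. g y \<partial>M)"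
proof -
  define E where "E n = (\<Union>(c, r) \<in> {(c, r). 0 < r \<and> r \<le> real n \<and>
      t * emeasure M (ball c r) < (\<integral>\<^sup>+ y \<in> ball c r. g y \<partial>M)}. ball c r)" for n :: nat
  have "{x. t < maxfun M g x} \<subseteq> (\<Union>n. E n)"
  proof
    fix x assume "x \<in> {x. t < maxfun M g x}"
    then obtain c r where *: "x \<in> ball c r" "t * emeasure M (ball c r) < (\<integral>\<^sup>+ y \<in> ball c r. g y \<partial>M)"
      by (auto simp: less_maxfun_iff less_average_iff)
    then have "0 < r" by (metis ball_eq_empty empty_iff not_le)
    then have "x \<in> E (nat \<lceil>r\<rceil>)"
      using * unfolding E_def by (intro UN_I[of "(c, r)"]) auto
    then show "x \<in> (\<Union>n. E n)" by blast
  qed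
  moreover have E_sets: "range E \<subseteq> sets M" by (auto simp: E_def intro!: open_sets)
  moreover have "incseq E" unfolding E_def by (intro incseq_SucI) force
  ultimately have "emeasure M {x. t < maxfun M g x} \<le> (SUP n. emeasure M (E n))"
    by (subst SUP_emeasure_incseq) (auto intro!: emeasure_mono)
  then have "t * emeasure M {x. t < maxfun M g x} \<le> (SUP n. t * emeasure M (E n))"
    by (subst SUP_mult_left_ennreal[symmetric]) (rule mult_left_mono, auto)
  also have "\<dots> \<le> ennreal D * (\<integral>\<^sup>+ y. g y \<partial>M)"
    unfolding E_def by (intro SUP_least weak_type_bounded_radii) auto
  finally show ?thesis .
qed

text \<open>Where \<open>2 * g \<le> t\<close>, \<open>g\<close> adds at most \<open>t / 2\<close>
  to any average. An average of \<open>g\<close> above \<open>t\<close> thus forces an average of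
  the large part \<open>h\<close> above \<open>t / 2\<close>, and the weak type bound at that level
  gives the factor 2.\<close>

lemma truncated_weak_type:
  assumes [measurable]: "g \<in> borel_measurable lebesgue" and "0 < t"
  shows "ennreal t * emeasure M {x. ennreal t < maxfun M g x}
    \<le> 2 * ennreal D * (\<integral>\<^sup>+ y. g y * indicator {y. ennreal t < 2 * g y} y \<partial>M)"
proof -
  define h where "h y = g y * indicator {y. ennreal t < 2 * g y} y" for y
  have [measurable]: "h \<in> borel_measurable lebesgue" unfolding h_def by measurable
  have t2: "2 * ennreal (t / 2) = ennreal t"
    using assms(2) by (simp add: ennreal_mult'[symmetric] flip: ennreal_numeral)
  have g_le: "g y \<le> h y + ennreal (t / 2)" for y
  proof (cases "ennreal t < 2 * g y")
    case False
    then have "2 * g y \<le> 2 * ennreal (t / 2)" unfolding t2 by simp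
    then have "g y \<le> ennreal (t / 2)"
      by (subst (asm) ennreal_mult_le_mult_iff) auto
    then show ?thesis by (simp add: add_increasing)
  qed (simp add: h_def)
  have "{x. ennreal t < maxfun M g x} \<subseteq> {x. ennreal (t / 2) < maxfun M h x}"
  proof
    fix x assume "x \<in> {x. ennreal t < maxfun M g x}"
    then obtain c r where *: "x \<in> ball c r"
        "ennreal t * emeasure M (ball c r) < (\<integral>\<^sup>+ y \<in> ball c r. g y \<partial>M)"
      by (auto simp: less_maxfun_iff less_average_iff)
    have "\<not> (\<integral>\<^sup>+ y \<in> ball c r. h y \<partial>M) \<le> ennreal (t / 2) * emeasure M (ball c r)"
    proof
      assume le: "(\<integral>\<^sup>+ y \<in> ball c r. h y \<partial>M) \<le> ennreal (t / 2) * emeasure M (ball c r)"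
      have "(\<integral>\<^sup>+ y \<in> ball c r. g y \<partial>M) \<le>
          (\<integral>\<^sup>+ y. h y * indicator (ball c r) y + ennreal (t / 2) * indicator (ball c r) y \<partial>M)"
        using g_le by (intro nn_integral_mono) (auto split: split_indicator)
      also have "\<dots> = (\<integral>\<^sup>+ y \<in> ball c r. h y \<partial>M) + ennreal (t / 2) * emeasure M (ball c r)"
        by (subst nn_integral_add) (auto simp: nn_integral_cmult_indicator)
      also have "\<dots> \<le> 2 * ennreal (t / 2) * emeasure M (ball c r)"
        using add_right_mono[OF le] by (simp add: mult_2 mult_2_right distrib_right)
      also have "\<dots> = ennreal t * emeasure M (ball c r)" unfolding t2 ..
      finally show False using * by simp
    qed
    then have "ennreal (t / 2) < (\<integral>\<^sup>+ y \<in> ball c r. h y \<partial>M) / emeasure M (ball c r)"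
      unfolding less_average_iff[OF *(1)] by simp
    then show "x \<in> {x. ennreal (t / 2) < maxfun M h x}"
      using *(1) unfolding less_maxfun_iff by blast
  qed
  moreover have "{x. ennreal (t / 2) < maxfun M h x} \<in> sets M"
    by (intro open_sets open_maxfun_greater)
  ultimately have "ennreal t * emeasure M {x. ennreal t < maxfun M g x}
      \<le> 2 * (ennreal (t / 2) * emeasure M {x. ennreal (t / 2) < maxfun M h x})"
    unfolding mult.assoc[symmetric] t2 by (intro mult_left_mono emeasure_mono) auto
  also have "\<dots> \<le> 2 * (ennreal D * (\<integral>\<^sup>+ y. h y \<partial>M))"
    by (intro mult_left_mono weak_type) auto
  finally show ?thesis by (simp add: h_def mult.assoc)
qed

text \<open>Marcinkiewicz interpolation: write the power by layers, apply the truncated weak type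
  bound at each level, exchange integrals, and sum the layers again. The constant is
  \<open>2 * q * 2 powr (q - 1) / (q - 1)\<close> times \<open>D\<close>.\<close>

lemma strong_type:
  assumes [measurable]: "g \<in> borel_measurable lebesgue" and "1 < q"
  shows "(\<integral>\<^sup>+ x. epowr (maxfun M g x) q \<partial>M)
    \<le> ennreal (2 powr q * q / (q - 1)) * ennreal D * (\<integral>\<^sup>+ x. epowr (g x) q \<partial>M)"
proof -
  interpret sigma_finite_measure M by (rule sigma_finite)
  interpret pair_sigma_finite lborel M ..
  have [measurable]: "maxfun M g \<in> borel_measurable M" "g \<in> borel_measurable M"
    by measurable
  have "(\<integral>\<^sup>+ x. epowr (maxfun M g x) q \<partial>M) = (\<integral>\<^sup>+ x. (\<integral>\<^sup>+ t. ennreal q * (ennreal (t powr (q - 1)) *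
      indicator {t. 0 < t \<and> ennreal t < maxfun M g x} t) \<partial>lborel) \<partial>M)"
    using assms(2)
    by (subst nn_integral_cmult, simp, subst epowr_layer_cake, simp,
       simp add: mult.assoc[symmetric] ennreal_mult'[symmetric])
  also have "\<dots> = (\<integral>\<^sup>+ t. (\<integral>\<^sup>+ x. ennreal q * (ennreal (t powr (q - 1)) *
      indicator {t. 0 < t \<and> ennreal t < maxfun M g x} t) \<partial>M) \<partial>lborel)"
    by (rule Fubini') measurable
  also have "\<dots> \<le> (\<integral>\<^sup>+ t. (\<integral>\<^sup>+ x. 2 * ennreal q * ennreal D * (g x * (ennreal (t powr (q - 1 - 1)) *
      indicator {t. 0 < t \<and> ennreal t < 2 * g x} t)) \<partial>M) \<partial>lborel)"
  proof (rule nn_integral_mono)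
    fix t :: real
    show "(\<integral>\<^sup>+ x. ennreal q * (ennreal (t powr (q - 1)) *
        indicator {t. 0 < t \<and> ennreal t < maxfun M g x} t) \<partial>M)
      \<le> (\<integral>\<^sup>+ x. 2 * ennreal q * ennreal D * (g x * (ennreal (t powr (q - 1 - 1)) *
      indicator {t. 0 < t \<and> ennreal t < 2 * g x} t)) \<partial>M)"
    proof (cases "0 < t")
      case True
      \<comment> \<open>One factor \<open>t\<close> is split off for the weak type bound, which
        lowers the layer exponent to \<open>q - 1\<close>.\<close>
      have tpow: "ennreal (t powr (q - 1)) = ennreal (t powr (q - 1 - 1)) * ennreal t"
        using True powr_add[of t "q - 1 - 1" 1] by (simp flip: ennreal_mult)
      have "(\<integral>\<^sup>+ x. ennreal q * (ennreal (t powr (q - 1)) *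
          indicator {t. 0 < t \<and> ennreal t < maxfun M g x} t) \<partial>M)
        = (\<integral>\<^sup>+ x. ennreal q * ennreal (t powr (q - 1)) *
          indicator {x. ennreal t < maxfun M g x} x \<partial>M)"
        using True by (intro nn_integral_cong) (auto split: split_indicator)
      also have "\<dots> = ennreal q * ennreal (t powr (q - 1 - 1)) *
          (ennreal t * emeasure M {x. ennreal t < maxfun M g x})"
        by (subst nn_integral_cmult_indicator)
          (auto simp: tpow mult.assoc intro!: open_sets open_maxfun_greater)
      also have "\<dots> \<le> ennreal q * ennreal (t powr (q - 1 - 1)) *
          (2 * ennreal D * (\<integral>\<^sup>+ y. g y * indicator {y. ennreal t < 2 * g y} y \<partial>M))"
        using True by (intro mult_left_mono truncated_weak_type) auto
      also have "\<dots> = (\<integral>\<^sup>+ x. 2 * ennreal q * ennreal D * ennreal (t powr (q - 1 - 1)) *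
          (g x * indicator {y. ennreal t < 2 * g y} x) \<partial>M)"
        by (subst nn_integral_cmult) (auto simp: ac_simps)
      also have "\<dots> = (\<integral>\<^sup>+ x. 2 * ennreal q * ennreal D * (g x * (ennreal (t powr (q - 1 - 1)) *
          indicator {t. 0 < t \<and> ennreal t < 2 * g x} t)) \<partial>M)"
        using True by (intro nn_integral_cong) (auto split: split_indicator simp: ac_simps)
      finally show ?thesis .
    qed simp
  qed
  also have "\<dots> = (\<integral>\<^sup>+ x. (\<integral>\<^sup>+ t. 2 * ennreal q * ennreal D * (g x * (ennreal (t powr (q - 1 - 1)) *
      indicator {t. 0 < t \<and> ennreal t < 2 * g x} t)) \<partial>lborel) \<partial>M)"
    by (rule Fubini'[symmetric]) measurable
  \<comment> \<open>The layer cake formula is now used with exponent \<open>q - 1\<close>, positive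
    since \<open>1 < q\<close>, and height \<open>2 * g x\<close>.\<close>
  also have "\<dots> = (\<integral>\<^sup>+ x. 2 * ennreal q * ennreal D * (g x *
      (ennreal (1 / (q - 1)) * epowr (2 * g x) (q - 1))) \<partial>M)"
    using assms(2)
    by (subst nn_integral_cmult, simp, subst nn_integral_cmult, simp, subst epowr_layer_cake) auto
  also have "\<dots> = (\<integral>\<^sup>+ x. ennreal (2 powr q * q / (q - 1)) * ennreal D * epowr (g x) q \<partial>M)"
  proof (intro nn_integral_cong)
    fix x
    have "2 * ennreal q * ennreal D * (g x * (ennreal (1 / (q - 1)) * epowr (2 * g x) (q - 1)))
       = (2 * ennreal q * ennreal (1 / (q - 1)) * epowr 2 (q - 1)) * ennreal D *
         (epowr (g x) 1 * epowr (g x) (q - 1))"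
      by (simp add: epowr_mult ac_simps)
    also have "2 * ennreal q * ennreal (1 / (q - 1)) * epowr 2 (q - 1) = ennreal (2 powr q * q / (q - 1))"
      using assms(2) epowr_ennreal[of 2 "q - 1"] powr_add[of 2 1 "q - 1"]
      by (simp add: ac_simps flip: ennreal_mult ennreal_numeral)
    also have "epowr (g x) 1 * epowr (g x) (q - 1) = epowr (g x) q"
      by (subst epowr_add) simp
    finally show "2 * ennreal q * ennreal D * (g x * (ennreal (1 / (q - 1)) * epowr (2 * g x) (q - 1)))
      = ennreal (2 powr q * q / (q - 1)) * ennreal D * epowr (g x) q" .
  qed
  also have "\<dots> = ennreal (2 powr q * q / (q - 1)) * ennreal D * (\<integral>\<^sup>+ x. epowr (g x) q \<partial>M)"
    by (subst nn_integral_cmult) auto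
  finally show ?thesis .
qed

end

section \<open>Domination by the heat semigroup\<close>

text \<open>Fatou's lemma makes the integral lower semicontinuous in \<open>x\<close>. Finiteness of
  \<open>g\<close> lets the product converge even where the kernel tends to \<open>0\<close>, as
  \<open>0 * top = 0\<close> would break continuity.\<close>

lemma open_nn_integral_kernel_greater:
  fixes k :: "'a::metric_space \<Rightarrow> 'b \<Rightarrow> real" and g :: "'b \<Rightarrow> ennreal"
  assumes [measurable]: "\<And>x. k x \<in> borel_measurable M" "g \<in> borel_measurable M"
    and cont: "\<And>y. continuous_on UNIV (\<lambda>x. k x y)"
    and finite: "\<And>y. g y < top"
  shows "open {x. a < (\<integral>\<^sup>+ y. ennreal (k x y) * g y \<partial>M)}"
proof -
  have "closed {x. (\<integral>\<^sup>+ y. ennreal (k x y) * g y \<partial>M) \<le> a}"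
    unfolding closed_sequential_limits
  proof (intro allI impI, elim conjE)
    fix X l
    assume le: "\<forall>n. X n \<in> {x. (\<integral>\<^sup>+ y. ennreal (k x y) * g y \<partial>M) \<le> a}" and lim: "X \<longlonglongrightarrow> l"
    have "(\<lambda>n. ennreal (k (X n) y) * g y) \<longlonglongrightarrow> ennreal (k l y) * g y" for y
    proof -
      have "(\<lambda>n. k (X n) y) \<longlonglongrightarrow> k l y"
        using cont[of y] lim continuous_on_tendsto_compose[of UNIV "\<lambda>x. k x y" X l] by simp
      then have "(\<lambda>n. g y * ennreal (k (X n) y)) \<longlonglongrightarrow> g y * ennreal (k l y)"
        by (intro ennreal_tendsto_cmult finite tendsto_ennrealI)
      then show ?thesis by (simp only: mult.commute)
    qed
    then have "(\<integral>\<^sup>+ y. ennreal (k l y) * g y \<partial>M)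
        = (\<integral>\<^sup>+ y. liminf (\<lambda>n. ennreal (k (X n) y) * g y) \<partial>M)"
      by (intro nn_integral_cong lim_imp_Liminf[symmetric]) auto
    also have "\<dots> \<le> liminf (\<lambda>n. \<integral>\<^sup>+ y. ennreal (k (X n) y) * g y \<partial>M)"
      by (intro nn_integral_liminf) measurable
    also have "\<dots> \<le> liminf (\<lambda>n::nat. a)"
      using le by (intro Liminf_mono) auto
    also have "\<dots> = a" by (simp add: Liminf_const)
    finally show "l \<in> {x. (\<integral>\<^sup>+ y. ennreal (k x y) * g y \<partial>M) \<le> a}" by simp
  qed
  then show ?thesis
    by (simp add: closed_def Compl_eq not_le)
qed

lemma continuous_imp_measurable_lebesgue:
  fixes f :: "'a::euclidean_space \<Rightarrow> 'b::topological_space"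
  assumes "continuous_on UNIV f"
  shows "f \<in> borel_measurable lebesgue"
  using borel_measurable_continuous_onI[OF assms] by (simp add: measurable_completion)

lemma continuous_on_OU_kernel:
  "continuous_on S (OU_kernel t x)" "continuous_on S (\<lambda>x. OU_kernel t x y)"
  unfolding OU_kernel_def[abs_def] divide_inverse by (intro continuous_intros)+

lemma continuous_on_heat_kernel:
  "continuous_on S (heat_kernel s x)" "continuous_on S (\<lambda>x. heat_kernel s x y)"
  unfolding heat_kernel_def[abs_def] divide_inverse by (intro continuous_intros)+

text \<open>The index set may be uncountable, so measurability comes from openness: superlevel sets
  of the supremum are unions of open ones.\<close>

lemma measurable_SUP_nn_integral_kernel:
  fixes k :: "'i \<Rightarrow> real ^ 'n \<Rightarrow> real ^ 'n \<Rightarrow> real" and g :: "real ^ 'n \<Rightarrow> ennreal"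
  assumes "g \<in> borel_measurable lebesgue" "\<And>y. g y < top"
    and "\<And>i y. i \<in> I \<Longrightarrow> continuous_on UNIV (\<lambda>x. k i x y)"
    and "\<And>i x. i \<in> I \<Longrightarrow> continuous_on UNIV (k i x)"
  shows "(\<lambda>x. SUP i\<in>I. (\<integral>\<^sup>+ y. ennreal (k i x y) * g y \<partial>lebesgue)) \<in> borel_measurable lebesgue"
proof (rule borel_measurableI_greater)
  fix a
  have "open (\<Union>i\<in>I. {x. a < (\<integral>\<^sup>+ y. ennreal (k i x y) * g y \<partial>lebesgue)})"
    using assms
    by (intro open_UN ballI open_nn_integral_kernel_greater)
      (auto intro: continuous_imp_measurable_lebesgue)
  also have "(\<Union>i\<in>I. {x. a < (\<integral>\<^sup>+ y. ennreal (k i x y) * g y \<partial>lebesgue)})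
      = {x \<in> space lebesgue. a < (SUP i\<in>I. (\<integral>\<^sup>+ y. ennreal (k i x y) * g y \<partial>lebesgue))}"
    by (auto simp: less_SUP_iff)
  finally show "{x \<in> space lebesgue. a < (SUP i\<in>I. (\<integral>\<^sup>+ y. ennreal (k i x y) * g y \<partial>lebesgue))} \<in> sets lebesgue"
    by simp
qed

lemma measurable_OU_maximal:
  assumes [measurable]: "f \<in> borel_measurable lebesgue"
  shows "OU_maximal f \<in> borel_measurable lebesgue"
  unfolding OU_maximal_def[abs_def] OU_semigroup_def
  by (intro measurable_SUP_nn_integral_kernel continuous_on_OU_kernel) auto

lemma measurable_local_heat_maximal:
  assumes [measurable]: "f \<in> borel_measurable lebesgue"
  shows "local_heat_maximal f \<in> borel_measurable lebesgue"
  unfolding local_heat_maximal_def[abs_def] heat_semigroup_def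
  by (intro measurable_SUP_nn_integral_kernel continuous_on_heat_kernel) auto

section \<open>Comparison of the Mehler and heat kernels\<close>

text \<open>Conjugated by the Gaussian, the Mehler kernel at time \<open>t\<close> has exponent
  \<open>-|x - y|\<^sup>2 / (4 s) - s |x + y|\<^sup>2 / 4\<close> with \<open>s = tanh (t / 2)\<close>.\<close>

lemma OU_kernel_le_heat_kernel:
  fixes x y :: "real ^ 'n"
  assumes "0 < t"
  shows "exp (- (norm x)\<^sup>2 / 2) * OU_kernel t x y
    \<le> 4 powr (real CARD('n) / 2) * (heat_kernel (tanh (t / 2)) x y * exp (- (norm y)\<^sup>2 / 2))"
proof -
  define r where "r = exp (- t)"
  define s where "s = (1 - r) / (1 + r)"
  define d where "d = real CARD('n) / 2"
  have r: "0 < r" "r < 1" using assms by (auto simp: r_def)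
  have s: "0 < s" "s < 1" using r by (auto simp: s_def)
  have tanh: "tanh (t / 2) = s"
    by (simp add: s_def r_def tanh_real_altdef)
  have r2: "exp (- 2 * t) = r\<^sup>2"
    by (simp add: r_def exp_double[symmetric])
  have "r\<^sup>2 < 1" using r by (simp add: power_less_one_iff)
  \<comment> \<open>Here \<open>1 + s = 2 / (1 + r)\<close>, so the right side is
    \<open>s * (1 + r)\<^sup>2 = (1 - r) * (1 + r)\<close>.\<close>
  have s4: "1 - r\<^sup>2 = 4 * s / (1 + s)\<^sup>2"
    using r by (simp add: s_def field_simps power2_eq_square)
  have expo: "- (norm x)\<^sup>2 / 2 + (- (norm (r *\<^sub>R x - y))\<^sup>2 / (1 - r\<^sup>2))
     = - (norm (x - y))\<^sup>2 / (4 * s) - s * (norm (x + y))\<^sup>2 / 4 + - (norm y)\<^sup>2 / 2"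
  proof -
    have nz: "1 - r \<noteq> 0" "1 + r \<noteq> 0" "1 - r\<^sup>2 = (1 - r) * (1 + r)"
      using r by (auto simp: power2_eq_square algebra_simps)
    define X Y Z where "X = (norm x)\<^sup>2" and "Y = (norm y)\<^sup>2" and "Z = x \<bullet> y"
    have n: "(norm (r *\<^sub>R x - y))\<^sup>2 = r\<^sup>2 * X - 2 * r * Z + Y"
      "(norm (x - y))\<^sup>2 = X - 2 * Z + Y" "(norm (x + y))\<^sup>2 = X + 2 * Z + Y"
      unfolding X_def Y_def Z_def power2_norm_eq_inner
      by (simp_all add: inner_simps inner_commute power2_eq_square)
    show ?thesis
      unfolding n X_def[symmetric] Y_def[symmetric] s_def nz(3) using nz(1,2)
      by (simp add: divide_simps) (simp add: algebra_simps power2_eq_square)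
  qed
  \<comment> \<open>The normalising factors differ by \<open>((1 + s)\<^sup>2) powr d\<close>, and
    \<open>s < 1\<close>.\<close>
  have const: "(1 / (pi * (1 - r\<^sup>2))) powr d \<le> 4 powr d * (1 / (4 * pi * s) powr d)"
  proof -
    have "1 / (pi * (1 - r\<^sup>2)) = (1 + s)\<^sup>2 * (1 / (4 * pi * s))"
      using s by (simp add: s4)
    also have "\<dots> \<le> 4 * (1 / (4 * pi * s))"
      using s power_mono[of "1 + s" 2 2] by (intro mult_right_mono) auto
    finally have "(1 / (pi * (1 - r\<^sup>2))) powr d \<le> (4 * (1 / (4 * pi * s))) powr d"
      using s \<open>r\<^sup>2 < 1\<close> by (intro powr_mono2) (auto simp: d_def)
    then show ?thesis using s by (simp add: powr_mult powr_divide)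
  qed
  have "exp (- (norm x)\<^sup>2 / 2) * OU_kernel t x y
      = (1 / (pi * (1 - r\<^sup>2))) powr d * exp (- (norm x)\<^sup>2 / 2 + (- (norm (r *\<^sub>R x - y))\<^sup>2 / (1 - r\<^sup>2)))"
    unfolding OU_kernel_def r2 exp_add by (simp add: r_def d_def)
  \<comment> \<open>The nonpositive term \<open>- s * (norm (x + y))\<^sup>2 / 4\<close> is dropped
    from the exponent.\<close>
  also have "\<dots> \<le> (4 powr d * (1 / (4 * pi * s) powr d)) *
      exp (- (norm (x - y))\<^sup>2 / (4 * s) + - (norm y)\<^sup>2 / 2)"
    using s unfolding expo by (intro mult_mono const) auto
  also have "\<dots> = 4 powr d * (heat_kernel s x y * exp (- (norm y)\<^sup>2 / 2))"
    unfolding exp_add by (simp add: heat_kernel_def d_def)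
  finally show ?thesis by (simp add: tanh d_def)
qed

text \<open>Integrating the kernel bound sends each time \<open>t > 0\<close> to the heat time
  \<open>tanh (t / 2)\<close>, which lies in \<open>(0, 1)\<close>; this is why the local heat
  maximal function controls all times.\<close>

lemma OU_maximal_le_local_heat_maximal:
  fixes f :: "real ^ 'n \<Rightarrow> complex"
  assumes [measurable]: "f \<in> borel_measurable lebesgue"
  shows "ennreal (exp (- (norm x)\<^sup>2 / 2)) * OU_maximal f x
    \<le> ennreal (4 powr (real CARD('n) / 2)) *
      local_heat_maximal (\<lambda>y. complex_of_real (exp (- (norm y)\<^sup>2 / 2)) * f y) x"
    (is "?e * _ \<le> ?c * local_heat_maximal ?F x")
proof -
  have [measurable]: "OU_kernel t x \<in> borel_measurable lebesgue"
      "heat_kernel t x \<in> borel_measurable lebesgue" for t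
    by (intro continuous_imp_measurable_lebesgue continuous_on_OU_kernel continuous_on_heat_kernel)+
  have [measurable]: "(\<lambda>y::real^'n. ennreal (exp (- ((norm y)\<^sup>2 / 2)))) \<in> borel_measurable lebesgue"
    by (intro measurable_completion) measurable
  have "?e * OU_semigroup t (\<lambda>y. ennreal (norm (f y))) x \<le> ?c * local_heat_maximal ?F x" if "0 < t" for t
  proof -
    have "?e * OU_semigroup t (\<lambda>y. ennreal (norm (f y))) x
        = (\<integral>\<^sup>+ y. ennreal (exp (- (norm x)\<^sup>2 / 2) * OU_kernel t x y) * ennreal (norm (f y)) \<partial>lebesgue)"
      unfolding OU_semigroup_def by (subst nn_integral_cmult[symmetric]) (auto simp: ennreal_mult' mult.assoc)
    also have "\<dots> \<le> (\<integral>\<^sup>+ y. ennreal (4 powr (real CARD('n) / 2) *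
        (heat_kernel (tanh (t / 2)) x y * exp (- (norm y)\<^sup>2 / 2))) * ennreal (norm (f y)) \<partial>lebesgue)"
      by (intro nn_integral_mono mult_right_mono ennreal_leI OU_kernel_le_heat_kernel that) simp
    also have "\<dots> = (\<integral>\<^sup>+ y. ?c * (ennreal (heat_kernel (tanh (t / 2)) x y) * ennreal (norm (?F y))) \<partial>lebesgue)"
      by (intro nn_integral_cong) (simp add: ennreal_mult' ennreal_mult'' norm_mult mult.assoc)
    also have "\<dots> = ?c * heat_semigroup (tanh (t / 2)) (\<lambda>y. ennreal (norm (?F y))) x"
      unfolding heat_semigroup_def norm_mult ennreal_mult'' [OF norm_ge_zero]
      by (subst nn_integral_cmult) auto
    also have "\<dots> \<le> ?c * local_heat_maximal ?F x"
      unfolding local_heat_maximal_def using that tanh_real_lt_1[of "t / 2"]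
      by (intro mult_left_mono SUP_upper) auto
    finally show ?thesis .
  qed
  then show ?thesis
    unfolding OU_maximal_def by (subst SUP_mult_left_ennreal) (auto intro!: SUP_least)
qed

text \<open>The Gaussian in the weight is the \<open>p\<close>-th power of
  \<open>exp (- (norm x)\<^sup>2 / 2)\<close>, so it can be moved into the function.\<close>

lemma Lp_norm_pow_gauss_weight:
  fixes g :: "real ^ 'n \<Rightarrow> ennreal"
  assumes [measurable]: "g \<in> borel_measurable lebesgue" "w \<in> borel_measurable lebesgue"
  shows "Lp_norm_pow p (gauss_weight p w) g
    = Lp_norm_pow p w (\<lambda>x. ennreal (exp (- (norm x)\<^sup>2 / 2)) * g x)"
proof -
  have [measurable]: "(\<lambda>x::real^'n. c * (norm x)\<^sup>2 / 2) \<in> borel_measurable lebesgue" for c :: real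
    by (intro measurable_completion) measurable
  have [measurable]: "(\<lambda>x::real^'n. - (norm x)\<^sup>2 / 2) \<in> borel_measurable lebesgue"
    by (intro measurable_completion) measurable
  show ?thesis
    unfolding Lp_norm_pow_def gauss_weight_def
    by (subst (1 2) nn_integral_density, measurable, intro nn_integral_cong)
      (simp add: epowr_mult epowr_ennreal ennreal_mult'' exp_powr_real ac_simps)
qed

text \<open>Multiplication by the Gaussian carries \<open>f\<close> to \<open>?F\<close>
  isometrically between the two weighted spaces. The pointwise domination then transfers the bound,
  its constant entering to the power \<open>p\<close>.\<close>

lemma Lp_bounded_by_OU_maximal:
  fixes w :: "real ^ 'n \<Rightarrow> real"
  assumes w: "weight w" and "0 \<le> p" and heat: "Lp_bounded_by p w local_heat_maximal K"
  shows "Lp_bounded_by p (gauss_weight p w) OU_maximal ((4 powr (real CARD('n) / 2)) powr p * K)"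
  unfolding Lp_bounded_by_def
proof (intro ballI conjI)
  fix f :: "real ^ 'n \<Rightarrow> complex" assume f: "f \<in> Lp_space p (gauss_weight p w)"
  have [measurable]: "f \<in> borel_measurable lebesgue" "w \<in> borel_measurable lebesgue"
    using f w by (auto simp: Lp_space_def weight_def)
  show OU [measurable]: "OU_maximal f \<in> borel_measurable lebesgue"
    by (rule measurable_OU_maximal) measurable
  let ?F = "\<lambda>y. complex_of_real (exp (- (norm y)\<^sup>2 / 2)) * f y"
  have "(\<lambda>y::real^'n. complex_of_real (exp (- (norm y)\<^sup>2 / 2))) \<in> borel_measurable lebesgue"
    by (intro measurable_completion) measurable
  then have F [measurable]: "?F \<in> borel_measurable lebesgue" by measurable
  have norm_F: "Lp_norm_pow p w (\<lambda>x. ennreal (norm (?F x)))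
      = Lp_norm_pow p (gauss_weight p w) (\<lambda>x. ennreal (norm (f x)))"
    by (subst Lp_norm_pow_gauss_weight) (auto simp: norm_mult ennreal_mult'')
  then have "?F \<in> Lp_space p w"
    using f F by (simp add: Lp_space_def)
  then have heat_F: "local_heat_maximal ?F \<in> borel_measurable lebesgue"
    "Lp_norm_pow p w (local_heat_maximal ?F) \<le> ennreal K * Lp_norm_pow p w (\<lambda>x. ennreal (norm (?F x)))"
    using heat by (auto simp: Lp_bounded_by_def)
  let ?c = "4 powr (real CARD('n) / 2)"
  have "Lp_norm_pow p (gauss_weight p w) (OU_maximal f)
      = Lp_norm_pow p w (\<lambda>x. ennreal (exp (- (norm x)\<^sup>2 / 2)) * OU_maximal f x)"
    by (rule Lp_norm_pow_gauss_weight) measurable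
  also have "\<dots> \<le> Lp_norm_pow p w (\<lambda>x. ennreal ?c * local_heat_maximal ?F x)"
    unfolding Lp_norm_pow_def
    by (intro nn_integral_mono epowr_mono OU_maximal_le_local_heat_maximal assms) measurable
  also have "\<dots> = ennreal (?c powr p) * Lp_norm_pow p w (local_heat_maximal ?F)"
    using heat_F(1) unfolding Lp_norm_pow_def
    by (subst nn_integral_cmult[symmetric]) (auto simp: epowr_mult epowr_ennreal)
  also have "\<dots> \<le> ennreal (?c powr p) * (ennreal K * Lp_norm_pow p w (\<lambda>x. ennreal (norm (?F x))))"
    by (intro mult_left_mono heat_F) auto
  also have "\<dots> = ennreal (?c powr p * K) * Lp_norm_pow p (gauss_weight p w) (\<lambda>x. ennreal (norm (f x)))"
    unfolding norm_F by (subst ennreal_mult') (auto simp: mult.assoc)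
  finally show "Lp_norm_pow p (gauss_weight p w) (OU_maximal f)
      \<le> ennreal (?c powr p * K) * Lp_norm_pow p (gauss_weight p w) (\<lambda>x. ennreal (norm (f x)))" .
qed

section \<open>Heat averages as sums of ball averages\<close>

lemma summable_gauss_times_power:
  "summable (\<lambda>k. exp (- (real k)\<^sup>2 / 4) * real (Suc k) ^ d)"
proof (rule summable_comparison_test')
  \<comment> \<open>With this \<open>c\<close> the \<open>d\<close>-th power of
    \<open>exp (real (Suc k) / c)\<close> is at most \<open>exp (real (Suc k) / 8)\<close>. Against
    \<open>exp (- real k / 4)\<close> it leaves a geometric series of ratio
    \<open>exp (- 1 / 8)\<close>.\<close>
  define c where "c = 8 * real (Suc d)"
  show "summable (\<lambda>k. (c ^ d * exp (1 / 8)) * exp (- 1 / 8 :: real) ^ k)"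
    by (intro summable_mult summable_geometric) simp
  fix k :: nat
  have "real (Suc k) \<le> c * exp (real (Suc k) / c)"
    using exp_ge_add_one_self[of "real (Suc k) / c"] by (simp add: c_def field_simps)
  then have "real (Suc k) ^ d \<le> (c * exp (real (Suc k) / c)) ^ d"
    by (intro power_mono) auto
  also have "\<dots> = c ^ d * exp (real d * (real (Suc k) / c))"
    by (simp only: power_mult_distrib exp_of_nat_mult)
  also have "\<dots> \<le> c ^ d * exp (real (Suc k) / 8)"
  proof -
    have "real d * (real (Suc k) / c) = real (Suc k) / 8 * (real d / real (Suc d))"
      by (simp add: c_def)
    also have "\<dots> \<le> real (Suc k) / 8 * 1" by (intro mult_left_mono) auto
    finally show ?thesis by (intro mult_left_mono) (auto simp: c_def)
  qed
  finally have power: "real (Suc k) ^ d \<le> c ^ d * exp (real (Suc k) / 8)" .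
  have square: "real k \<le> (real k)\<^sup>2"
    by (cases k) (auto simp: power2_eq_square)
  have "exp (- (real k)\<^sup>2 / 4) * real (Suc k) ^ d
      \<le> exp (- real k / 4) * (c ^ d * exp (real (Suc k) / 8))"
    using square power by (intro mult_mono) auto
  also have "\<dots> = c ^ d * exp (real k * (- 1 / 8) + 1 / 8)"
    by (simp add: exp_add[symmetric] field_simps)
  also have "\<dots> = (c ^ d * exp (1 / 8)) * exp (- 1 / 8) ^ k"
    unfolding exp_add exp_of_nat_mult by simp
  finally show "norm (exp (- (real k)\<^sup>2 / 4) * real (Suc k) ^ d)
    \<le> (c ^ d * exp (1 / 8)) * exp (- 1 / 8) ^ k" by simp
qed

lemma unit_ball_vol_neq_0 [simp]: "0 \<le> n \<Longrightarrow> unit_ball_vol n \<noteq> 0"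
  using unit_ball_vol_pos[of n] by (metis less_irrefl)

lemma emeasure_lebesgue_ball:
  fixes c :: "'a::euclidean_space"
  assumes "0 \<le> r"
  shows "emeasure lebesgue (ball c r) = ennreal (unit_ball_vol DIM('a) * r ^ DIM('a))"
  using emeasure_ball[OF assms, of c] by simp

lemma set_nn_integral_ball_le_maxfun:
  fixes c :: "'a::euclidean_space"
  assumes "0 < r"
  shows "(\<integral>\<^sup>+ y \<in> ball c r. g y \<partial>lebesgue)
    \<le> ennreal (unit_ball_vol DIM('a) * r ^ DIM('a)) * maxfun lebesgue g c"
proof -
  have V: "0 < unit_ball_vol DIM('a) * r ^ DIM('a)" using assms by simp
  have "(\<integral>\<^sup>+ y \<in> ball c r. g y \<partial>lebesgue)
      = ennreal (unit_ball_vol DIM('a) * r ^ DIM('a)) *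
        ((\<integral>\<^sup>+ y \<in> ball c r. g y \<partial>lebesgue) / emeasure lebesgue (ball c r))"
    unfolding emeasure_lebesgue_ball[OF less_imp_le[OF assms]] ennreal_times_divide
    using V assms by (subst mult.commute, subst ennreal_mult_divide_eq) auto
  also have "\<dots> \<le> ennreal (unit_ball_vol DIM('a) * r ^ DIM('a)) * maxfun lebesgue g c"
    using assms by (intro mult_left_mono average_le_maxfun) auto
  finally show ?thesis .
qed

text \<open>In units of \<open>sqrt s\<close>, term \<open>k\<close> is the Gaussian bound on the
  shell of distances from \<open>k\<close> to \<open>k + 1\<close>, times the volume of the ball of
  radius \<open>k + 1\<close>.\<close>

definition heat_maximal_const :: "nat \<Rightarrow> real" where
  "heat_maximal_const d = unit_ball_vol d * (\<Sum>k. exp (- (real k)\<^sup>2 / 4) * real (Suc k) ^ d)"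

lemma heat_semigroup_le_maxfun:
  fixes x :: "real ^ 'n"
  assumes [measurable]: "g \<in> borel_measurable lebesgue" and "0 < s"
  shows "heat_semigroup s g x \<le> ennreal (heat_maximal_const CARD('n)) * maxfun lebesgue g x"
proof -
  define \<rho> where "\<rho> = sqrt s"
  define N where "N = 1 / (4 * pi * s) powr (real CARD('n) / 2)"
  define v where "v = unit_ball_vol CARD('n)"
  have \<rho>: "0 < \<rho>" "\<rho>\<^sup>2 = s" using assms(2) by (auto simp: \<rho>_def)
  have N: "0 \<le> N" by (simp add: N_def)
  \<comment> \<open>The kernel's normalisation absorbs the volume scaling, since
    \<open>4 * pi \<ge> 1\<close>; this makes the bound uniform in \<open>s\<close>.\<close>
  have "N * \<rho> ^ CARD('n) \<le> 1"
  proof -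
    have "\<rho> ^ CARD('n) = s powr (real CARD('n) / 2)"
      using \<rho> powr_powr[of \<rho> 2 "real CARD('n) / 2"] by (simp add: powr_realpow)
    also have "\<dots> \<le> (4 * pi * s) powr (real CARD('n) / 2)"
      using assms(2) pi_gt3 by (intro powr_mono2) auto
    finally show ?thesis using assms(2) by (simp add: N_def divide_simps)
  qed
  have kernel: "ennreal (heat_kernel s x y) * g y
      \<le> (\<Sum>k. ennreal (N * exp (- (real k)\<^sup>2 / 4)) * (g y * indicator (ball x (real (Suc k) * \<rho>)) y))" for y
  proof -
    \<comment> \<open>The index of the shell containing \<open>y\<close>. That single term already
      dominates the kernel, and the others are nonnegative.\<close>
    define k where "k = nat \<lfloor>norm (x - y) / \<rho>\<rfloor>"
    have "real k = of_int \<lfloor>norm (x - y) / \<rho>\<rfloor>" using \<rho>(1) by (simp add: k_def)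
    then have "real k \<le> norm (x - y) / \<rho>" "norm (x - y) / \<rho> < real (Suc k)"
      by (auto simp: of_int_floor_le) linarith
    then have k: "real k * \<rho> \<le> norm (x - y)" "norm (x - y) < real (Suc k) * \<rho>"
      using \<rho>(1) by (simp_all add: field_simps)
    have "(real k)\<^sup>2 * s \<le> (norm (x - y))\<^sup>2"
      using power_mono[OF k(1), of 2] \<rho> by (simp add: power_mult_distrib)
    then have "- (norm (x - y))\<^sup>2 / (4 * s) \<le> - (real k)\<^sup>2 / 4"
      using assms(2) by (simp add: field_simps)
    then have "heat_kernel s x y \<le> N * exp (- (real k)\<^sup>2 / 4)"
      unfolding heat_kernel_def N_def[symmetric] using N by (intro mult_left_mono) auto
    then have "ennreal (heat_kernel s x y) * g y
        \<le> ennreal (N * exp (- (real k)\<^sup>2 / 4)) * (g y * indicator (ball x (real (Suc k) * \<rho>)) y)"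
      using k(2) by (intro mult_mono ennreal_leI) (auto simp: dist_norm)
    also have "\<dots> \<le> (\<Sum>k. ennreal (N * exp (- (real k)\<^sup>2 / 4)) * (g y * indicator (ball x (real (Suc k) * \<rho>)) y))"
      using sum_le_suminf[OF summableI, where I = "{k}" and f =
          "\<lambda>k. ennreal (N * exp (- (real k)\<^sup>2 / 4)) * (g y * indicator (ball x (real (Suc k) * \<rho>)) y)"]
      by simp
    finally show ?thesis .
  qed
  have "heat_semigroup s g x \<le>
      (\<integral>\<^sup>+ y. (\<Sum>k. ennreal (N * exp (- (real k)\<^sup>2 / 4)) * (g y * indicator (ball x (real (Suc k) * \<rho>)) y)) \<partial>lebesgue)"
    unfolding heat_semigroup_def by (intro nn_integral_mono kernel)
  also have "\<dots> = (\<Sum>k. ennreal (N * exp (- (real k)\<^sup>2 / 4)) * (\<integral>\<^sup>+ y \<in> ball x (real (Suc k) * \<rho>). g y \<partial>lebesgue))"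
    by (subst nn_integral_suminf, measurable) (simp add: nn_integral_cmult)
  also have "\<dots> \<le> (\<Sum>k. ennreal (v * (exp (- (real k)\<^sup>2 / 4) * real (Suc k) ^ CARD('n))) * maxfun lebesgue g x)"
  proof (intro suminf_le allI)
    fix k :: nat
    have "ennreal (N * exp (- (real k)\<^sup>2 / 4)) * (\<integral>\<^sup>+ y \<in> ball x (real (Suc k) * \<rho>). g y \<partial>lebesgue)
        \<le> ennreal (N * exp (- (real k)\<^sup>2 / 4)) *
          (ennreal (v * (real (Suc k) * \<rho>) ^ CARD('n)) * maxfun lebesgue g x)"
      using set_nn_integral_ball_le_maxfun[where r = "real (Suc k) * \<rho>" and c = x and g = g] \<rho>
      by (intro mult_left_mono) (auto simp: v_def)
    also have "\<dots> = ennreal ((N * \<rho> ^ CARD('n)) * (v * (exp (- (real k)\<^sup>2 / 4) * real (Suc k) ^ CARD('n)))) * maxfun lebesgue g x"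
      using N \<rho> by (subst mult.assoc[symmetric], subst ennreal_mult[symmetric])
        (auto simp: v_def power_mult_distrib ac_simps simp del: of_nat_Suc)
    also have "\<dots> \<le> ennreal (1 * (v * (exp (- (real k)\<^sup>2 / 4) * real (Suc k) ^ CARD('n)))) * maxfun lebesgue g x"
      using \<open>N * \<rho> ^ CARD('n) \<le> 1\<close>
      by (intro mult_right_mono ennreal_leI) (auto simp: v_def)
    finally show "ennreal (N * exp (- (real k)\<^sup>2 / 4)) * (\<integral>\<^sup>+ y \<in> ball x (real (Suc k) * \<rho>). g y \<partial>lebesgue)
        \<le> ennreal (v * (exp (- (real k)\<^sup>2 / 4) * real (Suc k) ^ CARD('n))) * maxfun lebesgue g x" by simp
  qed auto
  also have "\<dots> = ennreal (heat_maximal_const CARD('n)) * maxfun lebesgue g x"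
    unfolding heat_maximal_const_def v_def[symmetric] ennreal_suminf_multc
    using summable_gauss_times_power[of "CARD('n)"]
    by (subst suminf_ennreal2) (auto simp: v_def suminf_mult intro: summable_mult)
  finally show ?thesis .
qed

lemma local_heat_maximal_le_maxfun:
  fixes f :: "real ^ 'n \<Rightarrow> complex"
  assumes "f \<in> borel_measurable lebesgue"
  shows "local_heat_maximal f x
    \<le> ennreal (heat_maximal_const CARD('n)) * maxfun lebesgue (\<lambda>y. ennreal (norm (f y))) x"
  unfolding local_heat_maximal_def using assms
  by (intro SUP_least heat_semigroup_le_maxfun) auto

section \<open>Muckenhoupt's theorem\<close>

lemma weight_powr: "weight w \<Longrightarrow> weight (\<lambda>x. w x powr r)"
  unfolding weight_def by (auto simp: less_imp_neq[symmetric])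

lemma set_nn_integral_weight_ball_pos:
  fixes w :: "real ^ 'n \<Rightarrow> real"
  assumes "weight w" "0 < r"
  shows "0 < (\<integral>\<^sup>+ x \<in> ball c r. ennreal (w x) \<partial>lebesgue)"
proof -
  have [measurable]: "w \<in> borel_measurable lebesgue" using assms by (simp add: weight_def)
  have "\<not> (AE x in lebesgue. ennreal (w x) * indicator (ball c r) x = 0)"
  proof
    assume "AE x in lebesgue. ennreal (w x) * indicator (ball c r) x = 0"
    moreover have "ennreal (w x) \<noteq> 0" for x
      using assms by (simp add: weight_def ennreal_eq_0_iff not_le)
    ultimately have "AE x in lebesgue. x \<notin> ball c r"
      by (auto elim!: eventually_mono split: split_indicator_asm)
    then have "emeasure lebesgue (ball c r) = 0"
      by (subst (asm) AE_iff_measurable[of "ball c r"]) auto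
    moreover have "0 < unit_ball_vol CARD('n) * r ^ CARD('n)" using assms by simp
    ultimately show False using assms by (simp add: emeasure_ball ennreal_eq_0_iff)
  qed
  then show ?thesis
    by (subst zero_less_iff_neq_zero, subst nn_integral_0_iff_AE) auto
qed

text \<open>Volume of a cube over that of its inscribed ball. It passes from the cubes of
  \<open>Ap_char\<close> to the balls of \<open>maxfun\<close>.\<close>

definition cube_ball_ratio :: "nat \<Rightarrow> real" where
  "cube_ball_ratio d = 2 ^ d / unit_ball_vol d"

lemma cube_ball_ratio_pos [simp]: "0 < cube_ball_ratio d"
  by (simp add: cube_ball_ratio_def)

lemma ball_subset_cube:
  fixes c :: "real ^ 'n"
  assumes "0 < r"
  obtains Q where "Q \<in> cubes" "ball c r \<subseteq> Q"
    "emeasure lebesgue Q = ennreal (cube_ball_ratio CARD('n) * measure lebesgue (ball c r))"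
proof
  define a where "a = (\<chi> i. c $ i - r)"
  define b where "b = (\<chi> i. a $ i + 2 * r)"
  show "cbox a b \<in> cubes"
    using assms by (auto simp: cubes_def b_def intro!: exI[of _ a] exI[of _ "2 * r"])
  show sub: "ball c r \<subseteq> cbox a b"
  proof
    fix x assume "x \<in> ball c r"
    then have "\<bar>(x - c) $ i\<bar> < r" for i
      using component_le_norm_cart[of "x - c" i] by (simp add: dist_norm norm_minus_commute)
    then show "x \<in> cbox a b"
      by (auto simp: mem_box_cart a_def b_def abs_less_iff algebra_simps intro: less_imp_le)
  qed
  then have "cbox a b \<noteq> {}" using assms by auto
  then have "measure lebesgue (cbox a b) = (2 * r) ^ CARD('n)"
    by (simp add: content_cbox_cart b_def)
  then show "emeasure lebesgue (cbox a b)
      = ennreal (cube_ball_ratio CARD('n) * measure lebesgue (ball c r))"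
    using assms content_ball[of r c] emeasure_lborel_cbox_finite[of a b]
    by (subst emeasure_eq_ennreal_measure) (auto simp: cube_ball_ratio_def power_mult_distrib)
qed

text \<open>The \<open>A\<^sub>p\<close> bound on the circumscribed cube, raised to the power
  \<open>p\<close>, controls the smaller integrals over the ball.\<close>

lemma Ap_ball_upper:
  fixes w :: "real ^ 'n \<Rightarrow> real"
  assumes p: "1 < p" and w: "weight w" and A: "Ap_char p w = ennreal A" "0 \<le> A" and r: "0 < r"
  obtains W S where "0 < W" "0 < S"
    "(\<integral>\<^sup>+ x \<in> ball c r. ennreal (w x) \<partial>lebesgue) = ennreal W"
    "(\<integral>\<^sup>+ x \<in> ball c r. ennreal (w x powr (- 1 / (p - 1))) \<partial>lebesgue) = ennreal S"
    "W * S powr (p - 1) \<le> (A * cube_ball_ratio CARD('n) * measure lebesgue (ball c r)) powr p"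
proof -
  define \<sigma> where "\<sigma> x = w x powr (- 1 / (p - 1))" for x
  have \<sigma>: "weight \<sigma>" unfolding \<sigma>_def using w by (rule weight_powr)
  obtain Q where Q: "Q \<in> cubes" "ball c r \<subseteq> Q"
    "emeasure lebesgue Q = ennreal (cube_ball_ratio CARD('n) * measure lebesgue (ball c r))"
    using ball_subset_cube[OF r] by blast
  define V where "V = cube_ball_ratio CARD('n) * measure lebesgue (ball c r)"
  have V: "0 < V" "emeasure lebesgue Q = ennreal V"
    using r Q(3) content_ball[of r c] by (auto simp: V_def)
  have integral_le: "(\<integral>\<^sup>+ x \<in> ball c r. ennreal (u x) \<partial>lebesgue) \<le> avg Q u * ennreal V" for u
  proof -
    have "(\<integral>\<^sup>+ x \<in> ball c r. ennreal (u x) \<partial>lebesgue) \<le> (\<integral>\<^sup>+ x \<in> Q. ennreal (u x) \<partial>lebesgue)"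
      using Q(2) by (intro nn_integral_mono) (auto split: split_indicator)
    also have "\<dots> = avg Q u * ennreal V"
      using V by (simp add: avg_def ennreal_divide_times)
    finally show ?thesis .
  qed
  have avg_pos: "avg Q u \<noteq> 0" if "weight u" for u
    using integral_le[of u] set_nn_integral_weight_ball_pos[OF that r, of c] by auto
  have le: "epowr (avg Q w) (1 / p) * epowr (avg Q \<sigma>) ((p - 1) / p) \<le> ennreal A"
    unfolding A(1)[symmetric] Ap_char_def \<sigma>_def using Q(1) by (intro SUP_upper)
  \<comment> \<open>Both averages are nonzero, so an infinite one could not be hidden by
    \<open>0 * top = 0\<close> in a finite product.\<close>
  have "avg Q w \<noteq> top" "avg Q \<sigma> \<noteq> top"
    using le avg_pos[OF w] avg_pos[OF \<sigma>] by (auto simp: ennreal_top_mult ennreal_mult_top top_unique)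
  then obtain a b where ab: "0 \<le> a" "0 \<le> b" "avg Q w = ennreal a" "avg Q \<sigma> = ennreal b"
    by (cases "avg Q w" rule: ennreal_cases; cases "avg Q \<sigma>" rule: ennreal_cases) auto
  have "a powr (1 / p) * b powr ((p - 1) / p) \<le> A"
    using le ab A(2) by (simp add: epowr_ennreal flip: ennreal_mult)
  then have "(a powr (1 / p) * b powr ((p - 1) / p)) powr p \<le> A powr p"
    using p by (intro powr_mono2) auto
  then have ab_le: "a * b powr (p - 1) \<le> A powr p"
    using p ab by (simp add: powr_mult powr_powr)
  have fin: "(\<integral>\<^sup>+ x \<in> ball c r. ennreal (w x) \<partial>lebesgue) \<le> ennreal (a * V)"
    "(\<integral>\<^sup>+ x \<in> ball c r. ennreal (\<sigma> x) \<partial>lebesgue) \<le> ennreal (b * V)"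
    using integral_le[of w] integral_le[of \<sigma>] ab V by (auto simp flip: ennreal_mult)
  obtain W S where WS: "0 \<le> W" "0 \<le> S" "(\<integral>\<^sup>+ x \<in> ball c r. ennreal (w x) \<partial>lebesgue) = ennreal W"
    "(\<integral>\<^sup>+ x \<in> ball c r. ennreal (\<sigma> x) \<partial>lebesgue) = ennreal S"
    using fin
    by (cases "\<integral>\<^sup>+ x \<in> ball c r. ennreal (w x) \<partial>lebesgue" rule: ennreal_cases;
        cases "\<integral>\<^sup>+ x \<in> ball c r. ennreal (\<sigma> x) \<partial>lebesgue" rule: ennreal_cases)
      (auto simp: top_unique)
  have "W \<le> a * V" "S \<le> b * V" using fin WS ab V by auto
  then have "W * S powr (p - 1) \<le> (a * V) * (b * V) powr (p - 1)"
    using WS p ab V by (intro mult_mono powr_mono2) auto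
  also have "\<dots> = (a * b powr (p - 1)) * (V powr 1 * V powr (p - 1))"
    using ab V by (simp add: powr_mult)
  also have "\<dots> = (a * b powr (p - 1)) * V powr p"
    unfolding powr_add[symmetric] by simp
  also have "\<dots> \<le> A powr p * V powr p"
    by (intro mult_right_mono ab_le) auto
  also have "\<dots> = (A * cube_ball_ratio CARD('n) * measure lebesgue (ball c r)) powr p"
    using A V by (simp add: V_def powr_mult mult.assoc)
  finally have "W * S powr (p - 1) \<le> (A * cube_ball_ratio CARD('n) * measure lebesgue (ball c r)) powr p" .
  moreover have "0 < W" "0 < S"
    using set_nn_integral_weight_ball_pos[OF w r, of c] set_nn_integral_weight_ball_pos[OF \<sigma> r, of c] WS
    by auto
  ultimately show ?thesis using that WS unfolding \<sigma>_def by blast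
qed

text \<open>Instead of Hoelder's inequality: for every \<open>l > 0\<close> one of \<open>l w\<close> and
  \<open>(l w) powr (-1 / (p - 1))\<close> is at least one, and \<open>l\<close> is chosen so that the first integral is \<open>V/2\<close>.\<close>

lemma weight_ball_lower:
  fixes w :: "'a::euclidean_space \<Rightarrow> real"
  assumes p: "1 < p" and [measurable]: "w \<in> borel_measurable lebesgue" and pos: "\<And>x. 0 < w x"
    and r: "0 < r" and WS: "0 < W" "0 < S"
    "(\<integral>\<^sup>+ x \<in> ball c r. ennreal (w x) \<partial>lebesgue) = ennreal W"
    "(\<integral>\<^sup>+ x \<in> ball c r. ennreal (w x powr (- 1 / (p - 1))) \<partial>lebesgue) = ennreal S"
  shows "measure lebesgue (ball c r) powr p \<le> 2 powr p * (W * S powr (p - 1))"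
proof -
  define V where "V = measure lebesgue (ball c r)"
  have V: "0 < V" using r by (simp add: V_def content_ball)
  define l where "l = V / (2 * W)"
  have l: "0 < l" using V WS by (simp add: l_def)
  define m where "m = l powr (- 1 / (p - 1))"
  have pointwise: "1 \<le> ennreal l * ennreal (w x) + ennreal m * ennreal (w x powr (- 1 / (p - 1)))" for x
  proof -
    have "1 \<le> l * w x + m * w x powr (- 1 / (p - 1))"
    proof (cases "1 \<le> l * w x")
      case False
      have "1 powr (- 1 / (p - 1)) \<le> (l * w x) powr (- 1 / (p - 1))"
        using False p l pos[of x] by (intro powr_mono2') auto
      then show ?thesis using l pos[of x] by (simp add: m_def powr_mult add_increasing)
    qed (simp add: m_def add_increasing2)
    then show ?thesis
      using l pos[of x] by (simp add: m_def flip: ennreal_mult ennreal_plus ennreal_1)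
  qed
  have "ennreal V = emeasure lebesgue (ball c r)"
    using r by (simp add: V_def emeasure_ball content_ball)
  also have "\<dots> = (\<integral>\<^sup>+ x. indicator (ball c r) x \<partial>lebesgue)" by simp
  also have "\<dots> \<le> (\<integral>\<^sup>+ x. ennreal l * (ennreal (w x) * indicator (ball c r) x) +
      ennreal m * (ennreal (w x powr (- 1 / (p - 1))) * indicator (ball c r) x) \<partial>lebesgue)"
    using pointwise by (intro nn_integral_mono) (auto split: split_indicator)
  also have "\<dots> = ennreal (l * W + m * S)"
    using l by (subst nn_integral_add, measurable, subst (1 2) nn_integral_cmult, measurable)
      (simp only: WS(3,4), simp add: m_def ennreal_mult less_imp_le WS(1,2))
  finally have "V \<le> l * W + m * S"
    using WS l by (subst (asm) ennreal_le_iff) (auto simp: m_def)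
  \<comment> \<open>By the choice of \<open>l\<close>, the first term is exactly
    \<open>V / 2\<close>.\<close>
  then have "V / 2 \<le> m * S" using WS by (simp add: l_def)
  then have "(V / 2) powr (p - 1) \<le> (m * S) powr (p - 1)"
    using p V by (intro powr_mono2) auto
  also have "\<dots> = l powr (- 1) * S powr (p - 1)"
    using p WS by (simp add: m_def powr_mult powr_powr)
  also have "\<dots> = 2 * W / V * S powr (p - 1)"
    using l V WS by (simp add: powr_minus l_def)
  finally have "V * (V / 2) powr (p - 1) \<le> 2 * W * S powr (p - 1)"
    using V by (simp add: field_simps)
  moreover have "V * (V / 2) powr (p - 1) = 2 * (V / 2) powr p"
    using V powr_add[of "V / 2" 1 "p - 1"] by simp
  ultimately have "V powr p / 2 powr p \<le> W * S powr (p - 1)"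
    using V by (simp add: powr_divide)
  then show ?thesis by (simp add: V_def field_simps)
qed

text \<open>The upper bound on the large ball meets the lower bound on the small one, giving
  \<open>W5 * S5 powr (p - 1) \<le> D * (W * S powr (p - 1))\<close>. Since both integrals grow with
  the ball, either factor can be cancelled, which yields doubling for the other weight. In
  \<open>D\<close>, \<open>5 ^ CARD('n)\<close> is the volume ratio and 2 comes from the lower
  bound.\<close>

lemma Ap_doubling:
  fixes w :: "real ^ 'n \<Rightarrow> real"
  assumes p: "1 < p" and w: "weight w" and A: "Ap_char p w = ennreal A" "0 \<le> A"
  defines "D \<equiv> (A * cube_ball_ratio CARD('n) * 5 ^ CARD('n) * 2) powr p"
  shows "doubling_measure (density lebesgue (\<lambda>x. ennreal (w x))) D"
    and "doubling_measure (density lebesgue (\<lambda>x. ennreal (w x powr (- 1 / (p - 1))))) (D powr (1 / (p - 1)))"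
proof -
  define \<sigma> where "\<sigma> x = w x powr (- 1 / (p - 1))" for x
  have \<sigma>: "weight \<sigma>" unfolding \<sigma>_def using w by (rule weight_powr)
  have [measurable]: "w \<in> borel_measurable lebesgue" "\<sigma> \<in> borel_measurable lebesgue"
    using w \<sigma> by (auto simp: weight_def)
  have wpos: "0 < w x" for x using w by (simp add: weight_def)
  define \<mu> where "\<mu> = density lebesgue (\<lambda>x. ennreal (w x))"
  define \<nu> where "\<nu> = density lebesgue (\<lambda>x. ennreal (\<sigma> x))"
  have emeasure: "emeasure \<mu> (ball c r) = (\<integral>\<^sup>+ x \<in> ball c r. ennreal (w x) \<partial>lebesgue)"
    "emeasure \<nu> (ball c r) = (\<integral>\<^sup>+ x \<in> ball c r. ennreal (\<sigma> x) \<partial>lebesgue)" for c r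
    unfolding \<mu>_def \<nu>_def by (auto simp: emeasure_density)
  have key: "0 < emeasure \<mu> (ball c r) \<and> emeasure \<mu> (ball c r) < top \<and>
      0 < emeasure \<nu> (ball c r) \<and> emeasure \<nu> (ball c r) < top \<and>
      emeasure \<mu> (ball c (5 * r)) \<le> ennreal D * emeasure \<mu> (ball c r) \<and>
      emeasure \<nu> (ball c (5 * r)) \<le> ennreal (D powr (1 / (p - 1))) * emeasure \<nu> (ball c r)"
    if r: "0 < r" for c r
  proof -
    obtain W S where WS: "0 < W" "0 < S" "emeasure \<mu> (ball c r) = ennreal W" "emeasure \<nu> (ball c r) = ennreal S"
      unfolding emeasure \<sigma>_def by (rule Ap_ball_upper[OF p w A r, of c]) blast
    obtain W5 S5 where WS5: "0 < W5" "0 < S5" "emeasure \<mu> (ball c (5 * r)) = ennreal W5"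
      "emeasure \<nu> (ball c (5 * r)) = ennreal S5"
      and upper: "W5 * S5 powr (p - 1) \<le> (A * cube_ball_ratio CARD('n) * measure lebesgue (ball c (5 * r))) powr p"
      unfolding emeasure \<sigma>_def
      by (rule Ap_ball_upper[OF p w A, of "5 * r" c]) (use r in auto)
    have lower: "measure lebesgue (ball c r) powr p \<le> 2 powr p * (W * S powr (p - 1))"
      using WS unfolding emeasure \<sigma>_def by (intro weight_ball_lower p r) (auto simp: wpos)
    have "measure lebesgue (ball c (5 * r)) = 5 ^ CARD('n) * measure lebesgue (ball c r)"
      using r content_ball[of r c] content_ball[of "5 * r" c] by (simp add: power_mult_distrib)
    with upper have "W5 * S5 powr (p - 1)
        \<le> (A * cube_ball_ratio CARD('n) * 5 ^ CARD('n)) powr p * measure lebesgue (ball c r) powr p"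
      using A by (simp add: powr_mult less_imp_le mult.assoc)
    also have "\<dots> \<le> (A * cube_ball_ratio CARD('n) * 5 ^ CARD('n)) powr p * (2 powr p * (W * S powr (p - 1)))"
      by (intro mult_left_mono lower) auto
    also have "\<dots> = D * (W * S powr (p - 1))"
      using A unfolding D_def by (simp add: powr_mult less_imp_le)
    finally have main: "W5 * S5 powr (p - 1) \<le> D * (W * S powr (p - 1))" .
    have D: "0 \<le> D" by (simp add: D_def)
    have sub: "ball c r \<subseteq> ball c (5 * r)" using r by (intro subset_ball) auto
    have "emeasure \<mu> (ball c r) \<le> emeasure \<mu> (ball c (5 * r))"
        "emeasure \<nu> (ball c r) \<le> emeasure \<nu> (ball c (5 * r))"
      using sub by (auto intro!: emeasure_mono simp: \<mu>_def \<nu>_def)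
    then have le: "W \<le> W5" "S \<le> S5" using WS WS5 by auto
    \<comment> \<open>Enlarging \<open>S\<close> to \<open>S5\<close> on the right makes the dual
      factor cancel.\<close>
    have "W5 * S5 powr (p - 1) \<le> (D * W) * S5 powr (p - 1)"
      using main mult_left_mono[OF powr_mono2[OF _ _ le(2), of "p - 1"], of "D * W"] p D WS by simp
    then have "W5 \<le> D * W" using WS5 by simp
    \<comment> \<open>Shrinking \<open>W5\<close> to \<open>W\<close> on the left cancels
      \<open>W\<close>; the root of order \<open>p - 1\<close> follows.\<close>
    have "W * S5 powr (p - 1) \<le> W * (D * S powr (p - 1))"
      using main mult_right_mono[OF le(1), of "S5 powr (p - 1)"] by (simp add: mult.left_commute)
    then have "S5 powr (p - 1) \<le> D * S powr (p - 1)" using WS by simp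
    then have "(S5 powr (p - 1)) powr (1 / (p - 1)) \<le> (D * S powr (p - 1)) powr (1 / (p - 1))"
      using p by (intro powr_mono2) auto
    then have "S5 \<le> D powr (1 / (p - 1)) * S"
      using p WS WS5 D by (simp add: powr_mult powr_powr)
    then show ?thesis
      using WS WS5 \<open>W5 \<le> D * W\<close> D by (simp flip: ennreal_mult)
  qed
  have finite: "emeasure \<mu> (ball c r) < top" "emeasure \<nu> (ball c r) < top" for c r
    using key[of r c] by (cases "0 < r"; simp add: ball_empty)+
  show "doubling_measure (density lebesgue (\<lambda>x. ennreal (w x))) D"
    unfolding \<mu>_def[symmetric] using key finite by unfold_locales (auto simp: \<mu>_def)
  show "doubling_measure (density lebesgue (\<lambda>x. ennreal (w x powr (- 1 / (p - 1))))) (D powr (1 / (p - 1)))"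
    unfolding \<sigma>_def[symmetric] \<nu>_def[symmetric] using key finite by unfold_locales (auto simp: \<nu>_def)
qed

text \<open>Lerner's factorisation: if \<open>a\<close> is the average over a ball \<open>B\<close> of \<open>g / \<sigma>\<close> with respect to
  \<open>\<sigma> dx\<close>, then \<open>a\<close> is at most the \<open>\<sigma>\<close>-maximal function on all of \<open>B\<close>, and the \<open>A\<^sub>p\<close> condition turns
  the Lebesgue average of \<open>g\<close> into \<open>(a powr (p - 1) |B| / w(B)) powr (1 / (p - 1))\<close>.\<close>

lemma maxfun_lebesgue_le_iterated:
  fixes w :: "real ^ 'n \<Rightarrow> real"
  assumes p: "1 < p" and w: "weight w" and A: "Ap_char p w = ennreal A" "0 \<le> A"
    and g [measurable]: "g \<in> borel_measurable lebesgue"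
  defines "\<sigma> \<equiv> \<lambda>x. w x powr (- 1 / (p - 1))"
  defines "H \<equiv> maxfun (density lebesgue (\<lambda>x. ennreal (\<sigma> x))) (\<lambda>x. g x * ennreal (1 / \<sigma> x))"
  shows "maxfun lebesgue g x \<le> epowr (ennreal ((A * cube_ball_ratio CARD('n)) powr p) *
    maxfun (density lebesgue (\<lambda>x. ennreal (w x))) (\<lambda>x. epowr (H x) (p - 1) * ennreal (1 / w x)) x)
    (1 / (p - 1))"
proof -
  define \<mu> where "\<mu> = density lebesgue (\<lambda>x. ennreal (w x))"
  define \<nu> where "\<nu> = density lebesgue (\<lambda>x. ennreal (\<sigma> x))"
  define G where "G x = epowr (H x) (p - 1) * ennreal (1 / w x)" for x
  define B where "B = (A * cube_ball_ratio CARD('n)) powr p"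
  have \<sigma>: "weight \<sigma>" unfolding \<sigma>_def using w by (rule weight_powr)
  have [measurable]: "w \<in> borel_measurable lebesgue" "\<sigma> \<in> borel_measurable lebesgue"
    using w \<sigma> by (auto simp: weight_def)
  have pos: "0 < w x" "0 < \<sigma> x" for x using w \<sigma> by (auto simp: weight_def)
  have [measurable]: "H \<in> borel_measurable lebesgue" "G \<in> borel_measurable lebesgue"
    unfolding G_def H_def by measurable
  have "(\<integral>\<^sup>+ y \<in> ball c r. g y \<partial>lebesgue) / emeasure lebesgue (ball c r)
      \<le> epowr (ennreal B * maxfun \<mu> G x) (1 / (p - 1))" if x: "x \<in> ball c r" for c r
  proof -
    have r: "0 < r" using x by (metis ball_eq_empty empty_iff not_le)
    define V where "V = measure lebesgue (ball c r)"
    have V: "0 < V" "emeasure lebesgue (ball c r) = ennreal V"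
      using r by (simp_all add: V_def content_ball emeasure_ball)
    obtain W S where WS: "0 < W" "0 < S"
      "(\<integral>\<^sup>+ x \<in> ball c r. ennreal (w x) \<partial>lebesgue) = ennreal W"
      "(\<integral>\<^sup>+ x \<in> ball c r. ennreal (\<sigma> x) \<partial>lebesgue) = ennreal S"
      "W * S powr (p - 1) \<le> (A * cube_ball_ratio CARD('n) * V) powr p"
      unfolding \<sigma>_def V_def by (rule Ap_ball_upper[OF p w A r, of c]) blast
    have meas: "emeasure \<mu> (ball c r) = ennreal W" "emeasure \<nu> (ball c r) = ennreal S"
      unfolding \<mu>_def \<nu>_def by (simp_all add: emeasure_density WS)
    define I where "I = (\<integral>\<^sup>+ y \<in> ball c r. g y \<partial>lebesgue)"
    have "(\<integral>\<^sup>+ y \<in> ball c r. (g y * ennreal (1 / \<sigma> y)) \<partial>\<nu>)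
        = (\<integral>\<^sup>+ y. ennreal (\<sigma> y) * (g y * ennreal (1 / \<sigma> y) * indicator (ball c r) y) \<partial>lebesgue)"
      unfolding \<nu>_def by (subst nn_integral_density) auto
    also have "\<dots> = I"
      unfolding I_def
    proof (intro nn_integral_cong)
      fix y
      have "ennreal (\<sigma> y) * ennreal (1 / \<sigma> y) = 1"
        using pos[of y] by (simp flip: ennreal_mult)
      then show "ennreal (\<sigma> y) * (g y * ennreal (1 / \<sigma> y) * indicator (ball c r) y) = g y * indicator (ball c r) y"
        by (metis mult.assoc mult.commute mult.right_neutral)
    qed
    finally have I: "(\<integral>\<^sup>+ y \<in> ball c r. (g y * ennreal (1 / \<sigma> y)) \<partial>\<nu>) = I" .
    have H_ge: "I / ennreal S \<le> H y" if "y \<in> ball c r" for y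
      using average_le_maxfun[OF that, where g = "\<lambda>y. g y * ennreal (1 / \<sigma> y)" and M = \<nu>]
      unfolding H_def \<nu>_def[symmetric] I meas .
    define a where "a = epowr (I / ennreal S) (p - 1)"
    \<comment> \<open>The constant \<open>a\<close> lies below \<open>epowr (H y) (p - 1)\<close> on
      the whole ball. Integrating this, the density of \<open>\<mu>\<close> cancels the factor
      \<open>1 / w\<close> in \<open>G\<close>.\<close>
    have "a * ennreal V = (\<integral>\<^sup>+ y. a * indicator (ball c r) y \<partial>lebesgue)"
      unfolding V(2)[symmetric] by (subst nn_integral_cmult_indicator) auto
    also have "\<dots> \<le> (\<integral>\<^sup>+ y. epowr (H y) (p - 1) * indicator (ball c r) y \<partial>lebesgue)"
      unfolding a_def using p H_ge
      by (intro nn_integral_mono) (auto intro!: epowr_mono split: split_indicator)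
    also have "\<dots> = (\<integral>\<^sup>+ y. ennreal (w y) * (G y * indicator (ball c r) y) \<partial>lebesgue)"
    proof (intro nn_integral_cong)
      fix y
      have "ennreal (w y) * ennreal (1 / w y) = 1"
        using pos[of y] by (simp flip: ennreal_mult)
      then show "epowr (H y) (p - 1) * indicator (ball c r) y = ennreal (w y) * (G y * indicator (ball c r) y)"
        unfolding G_def by (metis mult.assoc mult.commute mult.right_neutral)
    qed
    also have "\<dots> = (\<integral>\<^sup>+ y \<in> ball c r. G y \<partial>\<mu>)"
      unfolding \<mu>_def by (subst nn_integral_density) auto
    finally have "a * ennreal V / ennreal W \<le> (\<integral>\<^sup>+ y \<in> ball c r. G y \<partial>\<mu>) / emeasure \<mu> (ball c r)"
      unfolding meas by (rule divide_right_mono_ennreal)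
    also have "\<dots> \<le> maxfun \<mu> G x" by (rule average_le_maxfun[OF x])
    finally have maxfun_ge: "a * ennreal (V / W) \<le> maxfun \<mu> G x"
      using V WS by (simp add: divide_ennreal ennreal_times_divide[symmetric] less_imp_le)
    \<comment> \<open>The \<open>A\<^sub>p\<close> bound on the ball, solved for the Lebesgue
      average \<open>S / V\<close> of \<open>\<sigma>\<close>.\<close>
    have ratio: "(S / V) powr (p - 1) \<le> B * (V / W)"
    proof -
      have "W * S powr (p - 1) \<le> B * (V powr 1 * V powr (p - 1))"
        using WS(5) A V unfolding powr_add[symmetric] by (simp add: B_def powr_mult less_imp_le)
      then show ?thesis using V WS by (simp add: powr_divide field_simps)
    qed
    \<comment> \<open>The average of \<open>g\<close> is its \<open>\<sigma>\<close>-average times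
      the average of \<open>\<sigma>\<close>; the power \<open>p - 1\<close> of the latter is
      controlled by \<open>ratio\<close>.\<close>
    have "I / ennreal V = I / ennreal S * ennreal (S / V)"
      using V WS by (simp add: divide_ennreal_def inverse_ennreal mult.assoc flip: ennreal_mult)
        (simp add: field_simps)
    then have "epowr (I / ennreal V) (p - 1) = a * ennreal ((S / V) powr (p - 1))"
      using V WS by (simp add: epowr_mult a_def epowr_ennreal)
    also have "\<dots> \<le> a * ennreal (B * (V / W))"
      by (intro mult_left_mono ennreal_leI ratio) simp
    also have "\<dots> = ennreal B * (a * ennreal (V / W))"
      by (subst ennreal_mult') (auto simp: B_def ac_simps)
    also have "\<dots> \<le> ennreal B * maxfun \<mu> G x"
      by (intro mult_left_mono maxfun_ge) simp
    finally have "epowr (epowr (I / ennreal V) (p - 1)) (1 / (p - 1))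
        \<le> epowr (ennreal B * maxfun \<mu> G x) (1 / (p - 1))"
      using p by (intro epowr_mono) auto
    then show ?thesis
      using p by (simp add: epowr_epowr V(2) I_def)
  qed
  then have "maxfun lebesgue g x \<le> epowr (ennreal B * maxfun \<mu> G x) (1 / (p - 1))"
    unfolding maxfun_def[of lebesgue] by (intro SUP_least) auto
  then show ?thesis unfolding B_def \<mu>_def G_def .
qed

text \<open>The strong type bound is applied with exponent \<open>q\<close> for \<open>\<mu>\<close>
  and then with exponent \<open>p\<close> for \<open>\<nu>\<close>; between them the norms match
  exactly. The constant is explicit so that it visibly depends only on \<open>A\<close>,
  \<open>p\<close> and the dimension.\<close>

theorem Muckenhoupt_maximal:
  fixes w :: "real ^ 'n \<Rightarrow> real"
  assumes p: "1 < p" and w: "weight w" and A: "Ap_char p w = ennreal A" "0 \<le> A"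
    and g [measurable]: "g \<in> borel_measurable lebesgue"
  defines "D \<equiv> (A * cube_ball_ratio CARD('n) * 5 ^ CARD('n) * 2) powr p"
  defines "q \<equiv> p / (p - 1)"
  shows "Lp_norm_pow p w (maxfun lebesgue g) \<le>
    ennreal (((A * cube_ball_ratio CARD('n)) powr p) powr q *
      (2 powr q * q / (q - 1) * D) * (2 powr p * p / (p - 1) * D powr (1 / (p - 1)))) * Lp_norm_pow p w g"
proof -
  define \<sigma> where "\<sigma> x = w x powr (- 1 / (p - 1))" for x
  define \<mu> where "\<mu> = density lebesgue (\<lambda>x. ennreal (w x))"
  define \<nu> where "\<nu> = density lebesgue (\<lambda>x. ennreal (\<sigma> x))"
  define h where "h x = g x * ennreal (1 / \<sigma> x)" for x
  define H where "H = maxfun \<nu> h"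
  define G where "G x = epowr (H x) (p - 1) * ennreal (1 / w x)" for x
  define B where "B = (A * cube_ball_ratio CARD('n)) powr p"
  have \<sigma>: "weight \<sigma>" unfolding \<sigma>_def using w by (rule weight_powr)
  have [measurable]: "w \<in> borel_measurable lebesgue" "\<sigma> \<in> borel_measurable lebesgue"
    using w \<sigma> by (auto simp: weight_def)
  have pos: "0 < w x" "0 < \<sigma> x" for x using w \<sigma> by (auto simp: weight_def)
  have h [measurable]: "h \<in> borel_measurable lebesgue" unfolding h_def by measurable
  have H [measurable]: "H \<in> borel_measurable lebesgue" unfolding H_def by measurable
  have G [measurable]: "G \<in> borel_measurable lebesgue" unfolding G_def by measurable
  have q: "1 < q" "q = 1 / (p - 1) * p" "(p - 1) * q = p" using p by (auto simp: q_def field_simps)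
  interpret \<mu>: doubling_measure \<mu> D
    unfolding \<mu>_def D_def by (rule Ap_doubling(1)[OF p w A])
  interpret \<nu>: doubling_measure \<nu> "D powr (1 / (p - 1))"
    unfolding \<nu>_def D_def \<sigma>_def by (rule Ap_doubling(2)[OF p w A])
  have D: "0 \<le> D" by (simp add: D_def)
  have "Lp_norm_pow p w (maxfun lebesgue g) \<le> (\<integral>\<^sup>+ x. epowr (ennreal B) q * epowr (maxfun \<mu> G x) q \<partial>\<mu>)"
    unfolding Lp_norm_pow_def \<mu>_def[symmetric]
  proof (intro nn_integral_mono)
    fix x
    have "epowr (maxfun lebesgue g x) p \<le> epowr (epowr (ennreal B * maxfun \<mu> G x) (1 / (p - 1))) p"
      unfolding B_def \<mu>_def G_def H_def \<nu>_def h_def \<sigma>_def using p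
      by (intro epowr_mono maxfun_lebesgue_le_iterated[OF p w A g]) auto
    then show "epowr (maxfun lebesgue g x) p \<le> epowr (ennreal B) q * epowr (maxfun \<mu> G x) q"
      by (simp only: epowr_epowr q(2)[symmetric] epowr_mult)
  qed
  also have "\<dots> = ennreal (B powr q) * (\<integral>\<^sup>+ x. epowr (maxfun \<mu> G x) q \<partial>\<mu>)"
    by (subst nn_integral_cmult) (auto simp: B_def epowr_ennreal)
  also have "\<dots> \<le> ennreal (B powr q) * (ennreal (2 powr q * q / (q - 1)) * ennreal D * (\<integral>\<^sup>+ x. epowr (G x) q \<partial>\<mu>))"
    by (intro mult_left_mono \<mu>.strong_type G q(1)) simp
  \<comment> \<open>Since \<open>1 - q = - 1 / (p - 1)\<close>, the factor
    \<open>w powr (1 - q)\<close> is \<open>\<sigma>\<close>, and \<open>(p - 1) * q = p\<close>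
    restores the power of \<open>H\<close>.\<close>
  also have "(\<integral>\<^sup>+ x. epowr (G x) q \<partial>\<mu>) = (\<integral>\<^sup>+ x. epowr (H x) p \<partial>\<nu>)"
    unfolding \<mu>_def \<nu>_def
  proof (subst (1 2) nn_integral_density, measurable, intro nn_integral_cong)
    fix x
    have "w x * (1 / w x) powr q = \<sigma> x"
    proof -
      have "w x * (1 / w x) powr q = w x powr 1 * w x powr (- q)"
        using pos[of x] by (simp add: powr_divide powr_minus_divide)
      also have "1 - q = - 1 / (p - 1)" using p by (simp add: q_def field_simps)
      then have "w x powr 1 * w x powr (- q) = \<sigma> x"
        unfolding powr_add[symmetric] by (simp add: \<sigma>_def)
      finally show ?thesis .
    qed
    then have "ennreal (w x) * epowr (ennreal (1 / w x)) q = ennreal (\<sigma> x)"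
      using pos[of x] by (simp add: epowr_ennreal flip: ennreal_mult)
    then show "ennreal (w x) * epowr (G x) q = ennreal (\<sigma> x) * epowr (H x) p"
      unfolding G_def epowr_mult epowr_epowr q(3) by (metis mult.assoc mult.commute)
  qed
  also have "(\<integral>\<^sup>+ x. epowr (H x) p \<partial>\<nu>) \<le> ennreal (2 powr p * p / (p - 1)) * ennreal (D powr (1 / (p - 1))) *
      (\<integral>\<^sup>+ x. epowr (h x) p \<partial>\<nu>)"
    unfolding H_def by (intro \<nu>.strong_type h p)
  \<comment> \<open>Dually, \<open>\<sigma> powr (1 - p)\<close> is \<open>w\<close>.\<close>
  also have "(\<integral>\<^sup>+ x. epowr (h x) p \<partial>\<nu>) = (\<integral>\<^sup>+ x. epowr (g x) p \<partial>\<mu>)"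
    unfolding \<mu>_def \<nu>_def
  proof (subst (1 2) nn_integral_density, measurable, intro nn_integral_cong)
    fix x
    have "\<sigma> x * (1 / \<sigma> x) powr p = w x"
    proof -
      have "\<sigma> x * (1 / \<sigma> x) powr p = \<sigma> x powr 1 * \<sigma> x powr (- p)"
        using pos[of x] by (simp add: powr_divide powr_minus_divide)
      also have "\<dots> = w x powr (- 1 / (p - 1) * (1 - p))"
        unfolding powr_add[symmetric] by (simp add: \<sigma>_def powr_powr)
      also have "- 1 / (p - 1) * (1 - p) = 1" using p by (simp add: field_simps)
      finally show ?thesis using pos[of x] by simp
    qed
    then have "ennreal (\<sigma> x) * epowr (ennreal (1 / \<sigma> x)) p = ennreal (w x)"
      using pos[of x] by (simp add: epowr_ennreal flip: ennreal_mult)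
    then show "ennreal (\<sigma> x) * epowr (h x) p = ennreal (w x) * epowr (g x) p"
      unfolding h_def epowr_mult by (metis mult.assoc mult.commute)
  qed
  also have "(\<integral>\<^sup>+ x. epowr (g x) p \<partial>\<mu>) = Lp_norm_pow p w g"
    by (simp add: Lp_norm_pow_def \<mu>_def)
  finally have le: "Lp_norm_pow p w (maxfun lebesgue g) \<le> ennreal (B powr q) *
      (ennreal (2 powr q * q / (q - 1)) * ennreal D *
        (ennreal (2 powr p * p / (p - 1)) * ennreal (D powr (1 / (p - 1))) * Lp_norm_pow p w g))"
    by (simp add: mult_left_mono)
  have "ennreal (B powr q * (2 powr q * q / (q - 1) * D) * (2 powr p * p / (p - 1) * D powr (1 / (p - 1))))
      = ennreal (B powr q) * ennreal (2 powr q * q / (q - 1) * D) *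
        ennreal (2 powr p * p / (p - 1) * D powr (1 / (p - 1)))"
  proof -
    have mult3: "ennreal (x * y * z) = ennreal x * ennreal y * ennreal z" if "0 \<le> x" "0 \<le> y" "0 \<le> z" for x y z
      using that by (simp add: ennreal_mult)
    show ?thesis using p q(1) D by (intro mult3) auto
  qed
  also have "ennreal (2 powr q * q / (q - 1) * D) = ennreal (2 powr q * q / (q - 1)) * ennreal D"
    using q(1) D by (intro ennreal_mult) auto
  also have "ennreal (2 powr p * p / (p - 1) * D powr (1 / (p - 1)))
      = ennreal (2 powr p * p / (p - 1)) * ennreal (D powr (1 / (p - 1)))"
    using p by (intro ennreal_mult) auto
  finally have const: "ennreal (B powr q * (2 powr q * q / (q - 1) * D) *
      (2 powr p * p / (p - 1) * D powr (1 / (p - 1)))) = ennreal (B powr q) *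
      (ennreal (2 powr q * q / (q - 1)) * ennreal D) *
      (ennreal (2 powr p * p / (p - 1)) * ennreal (D powr (1 / (p - 1))))" .
  show ?thesis
    unfolding B_def[symmetric] const using le by (simp only: mult.assoc)
qed

section \<open>Assembly of the bounds\<close>

lemma local_heat_maximal_bounded:
  fixes w :: "real ^ 'n \<Rightarrow> real"
  assumes p: "1 < p" and w: "weight w"
    and K: "\<And>g. g \<in> borel_measurable lebesgue \<Longrightarrow>
      Lp_norm_pow p w (maxfun lebesgue g) \<le> ennreal K * Lp_norm_pow p w g"
  shows "Lp_bounded_by p w local_heat_maximal (heat_maximal_const CARD('n) powr p * K)"
  unfolding Lp_bounded_by_def
proof (intro ballI conjI)
  fix f :: "real ^ 'n \<Rightarrow> complex" assume f: "f \<in> Lp_space p w"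
  then have [measurable]: "f \<in> borel_measurable lebesgue" by (simp add: Lp_space_def)
  have [measurable]: "w \<in> borel_measurable lebesgue" using w by (simp add: weight_def)
  show "local_heat_maximal f \<in> borel_measurable lebesgue"
    by (rule measurable_local_heat_maximal) measurable
  let ?c = "heat_maximal_const CARD('n)"
  let ?g = "\<lambda>x. ennreal (norm (f x))"
  have "0 \<le> ?c"
    unfolding heat_maximal_const_def by (intro mult_nonneg_nonneg suminf_nonneg summable_gauss_times_power) auto
  have "Lp_norm_pow p w (local_heat_maximal f) \<le> Lp_norm_pow p w (\<lambda>x. ennreal ?c * maxfun lebesgue ?g x)"
    unfolding Lp_norm_pow_def using p
    by (intro nn_integral_mono epowr_mono local_heat_maximal_le_maxfun) auto
  also have "\<dots> = ennreal (?c powr p) * Lp_norm_pow p w (maxfun lebesgue ?g)"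
    using \<open>0 \<le> ?c\<close> unfolding Lp_norm_pow_def
    by (subst nn_integral_cmult[symmetric]) (auto simp: epowr_mult epowr_ennreal)
  also have "\<dots> \<le> ennreal (?c powr p) * (ennreal K * Lp_norm_pow p w ?g)"
    by (intro mult_left_mono K) auto
  also have "\<dots> = ennreal (?c powr p * K) * Lp_norm_pow p w ?g"
    by (subst ennreal_mult') (auto simp: mult.assoc)
  finally show "Lp_norm_pow p w (local_heat_maximal f) \<le> ennreal (?c powr p * K) * Lp_norm_pow p w ?g" .
qed

theorem theorem3p5:
  fixes p :: real
  assumes "1 < p"
  shows "(\<exists>C :: ennreal \<Rightarrow> real. \<forall>w0 :: real ^ 'n \<Rightarrow> real. Ap_weight p w0 \<longrightarrow>
            Lp_bounded_by p (gauss_weight p w0) OU_maximal (C (Ap_char p w0)))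
       \<and> (\<forall>w0 :: real ^ 'n \<Rightarrow> real. weight w0 \<and> Lp_bounded p w0 local_heat_maximal \<longrightarrow>
            Lp_bounded p (gauss_weight p w0) OU_maximal)"
proof (intro conjI allI impI)
  \<comment> \<open>One constant serves all weights of the same characteristic \<open>a\<close>;
    choosing it for each \<open>a\<close> then gives the function \<open>C\<close>.\<close>
  have "\<exists>K. \<forall>w0 :: real ^ 'n \<Rightarrow> real. Ap_weight p w0 \<and> Ap_char p w0 = a \<longrightarrow>
      Lp_bounded_by p (gauss_weight p w0) OU_maximal K" for a
  proof (cases a rule: ennreal_cases)
    case (real A)
    define D where "D = (A * cube_ball_ratio CARD('n) * 5 ^ CARD('n) * 2) powr p"
    define q where "q = p / (p - 1)"
    define K where "K = ((A * cube_ball_ratio CARD('n)) powr p) powr q *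
      (2 powr q * q / (q - 1) * D) * (2 powr p * p / (p - 1) * D powr (1 / (p - 1)))"
    show ?thesis
    proof (intro exI allI impI, elim conjE)
      fix w0 :: "real ^ 'n \<Rightarrow> real"
      assume w0: "Ap_weight p w0" "Ap_char p w0 = a"
      then have w: "weight w0" and A: "Ap_char p w0 = ennreal A" "0 \<le> A"
        using real by (auto simp: Ap_weight_def)
      have "Lp_bounded_by p w0 local_heat_maximal (heat_maximal_const CARD('n) powr p * K)"
        unfolding K_def D_def q_def
        by (intro local_heat_maximal_bounded[OF assms w] Muckenhoupt_maximal assms w A)
      then show "Lp_bounded_by p (gauss_weight p w0) OU_maximal
          ((4 powr (real CARD('n) / 2)) powr p * (heat_maximal_const CARD('n) powr p * K))"
        using assms by (intro Lp_bounded_by_OU_maximal w) auto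
    qed
  \<comment> \<open>For \<open>a = top\<close> the claim is vacuous, as an \<open>A\<^sub>p\<close>
    weight has finite characteristic.\<close>
  qed (auto simp: Ap_weight_def)
  then show "\<exists>C :: ennreal \<Rightarrow> real. \<forall>w0 :: real ^ 'n \<Rightarrow> real. Ap_weight p w0 \<longrightarrow>
      Lp_bounded_by p (gauss_weight p w0) OU_maximal (C (Ap_char p w0))"
    by metis
next
  fix w0 :: "real ^ 'n \<Rightarrow> real"
  assume "weight w0 \<and> Lp_bounded p w0 local_heat_maximal"
  then show "Lp_bounded p (gauss_weight p w0) OU_maximal"
    using assms Lp_bounded_by_OU_maximal[of w0 p] unfolding Lp_bounded_def by fastforce
qed

end
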